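(* Suppose the sampling and moment assumptions stated in the context hold. For $C<\infty$ let $$h_{x,a,b}(y,z)=(y-z'b)\{\mathbf 1(z\preceq x)-a'z\},\qquad d_{x,a,b}=h_{x,a,b}-r_x,\qquad \mathcal D_C=\{d_{x,a,b}:x\in\mathcal X,\ \|a\|\le C,\ \|b\|\le C\}.$$ Then there exist fixed constants $C,C'<\infty$ such that $D(y,z)=C'(1+|y|)$ is an envelope of $\mathcal D_C$, and finite constants $A_0,v_0$, not depending on the probability measure $L$, such that $$\sup_LN\{\epsilon\|D\|_{L,2},\mathcal D_C,L_2(L)\}\le(A_0/\epsilon)^{v_0},\qquad0<\epsilon\le1.$$ Moreover, with $A_n(x)=Q_n^{-1}M_n(x)$, with probability tending to one, $$\widehat r_{ij}(x)-r_x(Z_{ij})=d_{x,A_n(x),\widehat\beta}(Z_{ij})\quad\text{for every }x\in\mathcal X\ (\text{and all }1\le i<j\le n),$$ and $d_{x,A_n(x),\widehat\beta}\in\mathcal D_C$ for every $x\in\mathcal X$. In addition, $$\mathbb P_n\sup_{x\in\mathcal X}\big|d_{x,A_n(x),\widehat\beta}\big|^2=o_p(1).$$ The class $\mathcal D_C$ may be chosen pointwise measurable.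
   Context: Sampling assumption: node variables $(U_i)_{i\ge1}$ are i.i.d., dyad variables $(U_{ij})_{i<j}$ are i.i.d., and all are mutually independent. For $i<j$, $Z_{ij}=(Y_{ij},X_{ij}')'=\tau(U_i,U_j,U_{ij})$ with $\tau$ measurable and symmetric in its first two arguments, $Y_{ij}\in\mathbb R$, $X_{ij}\in\mathcal X\subset\mathbb R^d$, $\mathcal X$ a compact rectangle. One observes $Z_{ij}$ for $1\le i<j\le n$. $N_n=n(n-1)/2$, $\mathbb P_nf=N_n^{-1}\sum_{i<j}f(Z_{ij})$. Moment assumption: $\|X_{12}\|\le C_X<\infty$ a.s.; $E|Y_{12}|^{4+\delta}<\infty$ for some $\delta>0$; $Q=E[X_{12}X_{12}']$ has smallest eigenvalue bounded away from zero. Objects ($\preceq$ is coordinatewise inequality): $\beta_*=Q^{-1}E[X_{12}Y_{12}]$, $M(x)=E[X_{12}\mathbf 1\{X_{12}\preceq x\}]$, $r_x(y,z)=(y-z'\beta_* )\{\mathbf 1(z\preceq x)-M(x)'Q^{-1}z\}$. Estimated objects (arbitrary if $Q_n$ is singular): $Q_n=\mathbb P_n(XX')$, $\widehat\beta=Q_n^{-1}\mathbb P_n(XY)$, $M_n(x)=\mathbb P_n[X\mathbf 1\{X\preceq x\}]$, $\widehat r_{ij}(x)=(Y_{ij}-X_{ij}'\widehat\beta)\{\mathbf 1(X_{ij}\preceq x)-M_n(x)'Q_n^{-1}X_{ij}\}$. All functions are regarded as functions of $(y,z)$ with $y\in\mathbb R$, $z\in\mathcal X$, $\|z\|\le C_X$,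 and $L$ ranges over probability measures on this set (with $\|D\|_{L,2}<\infty$); $\|f\|_{L,2}=(L|f|^2)^{1/2}$ and $N$ denotes covering numbers. An envelope of a class dominates the absolute value of every member. A class is pointwise measurable if it has a countable subclass such that each member is a pointwise limit of a sequence from it. *)

theory Defs
  imports "HOL-Probability.Probability"
begin

text \<open>
  Node variables \<open>U i\<close> and dyad variables \<open>V i j\<close> may take values in different spaces, so the
  library's \<open>indep_vars\<close>, which needs a common value type, does not apply to the joint family. The
  following is its unfolding to the generated families of events, over the index set of all
  nodes and all dyads.
\<close>

definition indep_nodes_dyads ::
  "'w measure \<Rightarrow> 'u measure \<Rightarrow> 'v measure \<Rightarrow> (nat \<Rightarrow> 'w \<Rightarrow> 'u) \<Rightarrow> (nat \<Rightarrow> nat \<Rightarrow> 'w \<Rightarrow> 'v) \<Rightarrow> bool"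
where
  "indep_nodes_dyads P NU NV U V \<longleftrightarrow>
     prob_space.indep_sets P
       (case_sum (\<lambda>i. {U i -` A \<inter> space P | A. A \<in> sets NU})
                 (\<lambda>(i, j). {V i j -` A \<inter> space P | A. A \<in> sets NV}))
       (Inl ` {1..} \<union> Inr ` {(i, j). 1 \<le> i \<and> i < j})"

definition iid_nodes_dyads ::
  "'w measure \<Rightarrow> 'u measure \<Rightarrow> 'v measure \<Rightarrow> (nat \<Rightarrow> 'w \<Rightarrow> 'u) \<Rightarrow> (nat \<Rightarrow> nat \<Rightarrow> 'w \<Rightarrow> 'v) \<Rightarrow> bool"
where
  "iid_nodes_dyads P NU NV U V \<longleftrightarrow>
     (\<forall>i\<ge>1. U i \<in> measurable P NU \<and> distr P NU (U i) = distr P NU (U 1)) \<and>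
     (\<forall>i\<ge>1. \<forall>j>i. V i j \<in> measurable P NV \<and> distr P NV (V i j) = distr P NV (V 1 2)) \<and>
     indep_nodes_dyads P NU NV U V"

definition dyads :: "nat \<Rightarrow> (nat \<times> nat) set" where
  "dyads n = {(i, j). 1 \<le> i \<and> i < j \<and> j \<le> n}"

definition emp_mean :: "nat \<Rightarrow> (nat \<Rightarrow> nat \<Rightarrow> 'z) \<Rightarrow> ('z \<Rightarrow> 'b::real_vector) \<Rightarrow> 'b" where
  "emp_mean n \<zeta> f = (1 / (real n * (real n - 1) / 2)) *\<^sub>R (\<Sum>(i, j)\<in>dyads n. f (\<zeta> i j))"

text \<open>
  \<open>measure\<close> of a non-measurable set is \<open>0\<close>, so these are phrased with measurable inner events. For
  measurable predicates and variables they are the usual notions.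
\<close>

definition with_prob_tending_to_1 :: "'w measure \<Rightarrow> (nat \<Rightarrow> 'w \<Rightarrow> bool) \<Rightarrow> bool" where
  "with_prob_tending_to_1 P \<Phi> \<longleftrightarrow>
     (\<exists>E. (\<forall>n. E n \<in> sets P \<and> (\<forall>\<omega>\<in>E n. \<Phi> n \<omega>)) \<and> (\<lambda>n. measure P (E n)) \<longlonglongrightarrow> 1)"

definition op1 :: "'w measure \<Rightarrow> (nat \<Rightarrow> 'w \<Rightarrow> real) \<Rightarrow> bool" where
  "op1 P W \<longleftrightarrow> (\<forall>\<epsilon>>0. with_prob_tending_to_1 P (\<lambda>n \<omega>. \<bar>W n \<omega>\<bar> \<le> \<epsilon>))"

definition square_integrable :: "'z measure \<Rightarrow> ('z \<Rightarrow> real) \<Rightarrow> bool" where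
  "square_integrable L f \<longleftrightarrow> f \<in> borel_measurable L \<and> integrable L (\<lambda>p. \<bar>f p\<bar>^2)"

definition L2_norm :: "'z measure \<Rightarrow> ('z \<Rightarrow> real) \<Rightarrow> real" where
  "L2_norm L f = sqrt (\<integral>p. \<bar>f p\<bar>^2 \<partial>L)"

text \<open>
  Open balls; the centres are square integrable but need not lie in the class. The value is
  \<open>\<infinity>\<close> if no finite cover exists, in particular if some member is not square integrable.
\<close>

definition covering_number :: "real \<Rightarrow> ('z \<Rightarrow> real) set \<Rightarrow> 'z measure \<Rightarrow> enat" where
  "covering_number e F L =
     (INF G\<in>{G. finite G \<and> (\<forall>g\<in>G. square_integrable L g) \<and>
                (\<forall>f\<in>F. square_integrable L f \<and> (\<exists>g\<in>G. L2_norm L (\<lambda>p. f p - g p) < e))}.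
        enat (card G))"

text \<open>Functions are total on the type; only their values on the domain \<open>S\<close> matter below.\<close>

definition envelope_on :: "'z set \<Rightarrow> ('z \<Rightarrow> real) set \<Rightarrow> ('z \<Rightarrow> real) \<Rightarrow> bool" where
  "envelope_on S F D \<longleftrightarrow> (\<forall>f\<in>F. \<forall>p\<in>S. \<bar>f p\<bar> \<le> D p)"

definition pointwise_measurable_on :: "'z set \<Rightarrow> ('z \<Rightarrow> real) set \<Rightarrow> bool" where
  "pointwise_measurable_on S F \<longleftrightarrow>
     (\<exists>G\<subseteq>F. countable G \<and>
        (\<forall>f\<in>F. \<exists>g. (\<forall>m. g m \<in> G) \<and> (\<forall>p\<in>S. (\<lambda>m. g m p) \<longlonglongrightarrow> f p)))"

definition prob_measures_L2 ::
  "'z::topological_space set \<Rightarrow> ('z \<Rightarrow> real) \<Rightarrow> 'z measure set" where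
  "prob_measures_L2 S D =
     {L. prob_space L \<and> space L = S \<and> sets L = sets (restrict_space borel S) \<and>
         square_integrable L D}"

definition outer :: "real ^ 'd \<Rightarrow> real ^ 'd ^ 'd" where
  "outer z = (\<chi> k l. z $ k * z $ l)"

definition eigenvalue :: "real ^ 'd ^ 'd \<Rightarrow> real \<Rightarrow> bool" where
  "eigenvalue A c \<longleftrightarrow> (\<exists>v. v \<noteq> 0 \<and> A *v v = c *\<^sub>R v)"

text \<open>
  An observation is a pair \<open>(y, z)\<close> of outcome and regressor. In the population objects \<open>W\<close>
  is a random variable with the law of one observation. The order on \<open>real ^ 'd\<close> is
  coordinatewise.
\<close>

definition pop_Q :: "'w measure \<Rightarrow> ('w \<Rightarrow> real \<times> (real ^ 'd)) \<Rightarrow> real ^ 'd ^ 'd" where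
  "pop_Q P W = (\<integral>\<omega>. outer (snd (W \<omega>)) \<partial>P)"

definition beta_star :: "'w measure \<Rightarrow> ('w \<Rightarrow> real \<times> (real ^ 'd)) \<Rightarrow> real ^ 'd" where
  "beta_star P W = matrix_inv (pop_Q P W) *v (\<integral>\<omega>. fst (W \<omega>) *\<^sub>R snd (W \<omega>) \<partial>P)"

definition pop_M :: "'w measure \<Rightarrow> ('w \<Rightarrow> real \<times> (real ^ 'd)) \<Rightarrow> real ^ 'd \<Rightarrow> real ^ 'd" where
  "pop_M P W x = (\<integral>\<omega>. of_bool (snd (W \<omega>) \<le> x) *\<^sub>R snd (W \<omega>) \<partial>P)"

definition r_fun :: "'w measure \<Rightarrow> ('w \<Rightarrow> real \<times> (real ^ 'd)) \<Rightarrow> real ^ 'd \<Rightarrow> real \<times> (real ^ 'd) \<Rightarrow> real"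
where
  "r_fun P W x = (\<lambda>(y, z). (y - z \<bullet> beta_star P W) *
     (of_bool (z \<le> x) - pop_M P W x \<bullet> (matrix_inv (pop_Q P W) *v z)))"

definition h_fun :: "real ^ 'd \<Rightarrow> real ^ 'd \<Rightarrow> real ^ 'd \<Rightarrow> real \<times> (real ^ 'd) \<Rightarrow> real" where
  "h_fun x a b = (\<lambda>(y, z). (y - z \<bullet> b) * (of_bool (z \<le> x) - a \<bullet> z))"

definition d_fun :: "'w measure \<Rightarrow> ('w \<Rightarrow> real \<times> (real ^ 'd)) \<Rightarrow>
    real ^ 'd \<Rightarrow> real ^ 'd \<Rightarrow> real ^ 'd \<Rightarrow> real \<times> (real ^ 'd) \<Rightarrow> real" where
  "d_fun P W x a b = (\<lambda>p. h_fun x a b p - r_fun P W x p)"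

definition D_class :: "'w measure \<Rightarrow> ('w \<Rightarrow> real \<times> (real ^ 'd)) \<Rightarrow> (real ^ 'd) set \<Rightarrow> real \<Rightarrow>
    (real \<times> (real ^ 'd) \<Rightarrow> real) set" where
  "D_class P W \<X> C = {d_fun P W x a b | x a b. x \<in> \<X> \<and> norm a \<le> C \<and> norm b \<le> C}"

text \<open>In the sample objects \<open>\<zeta>\<close> is a realisation of the array of observations.\<close>

definition emp_Q :: "nat \<Rightarrow> (nat \<Rightarrow> nat \<Rightarrow> real \<times> (real ^ 'd)) \<Rightarrow> real ^ 'd ^ 'd" where
  "emp_Q n \<zeta> = emp_mean n \<zeta> (\<lambda>(y, z). outer z)"

definition emp_M :: "nat \<Rightarrow> (nat \<Rightarrow> nat \<Rightarrow> real \<times> (real ^ 'd)) \<Rightarrow> real ^ 'd \<Rightarrow> real ^ 'd" where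
  "emp_M n \<zeta> x = emp_mean n \<zeta> (\<lambda>(y, z). of_bool (z \<le> x) *\<^sub>R z)"

text \<open>
  The estimators are unconstrained when \<open>emp_Q n \<zeta>\<close> is singular, hence predicates on candidate
  values rather than functions.
\<close>

definition is_beta_hat :: "nat \<Rightarrow> (nat \<Rightarrow> nat \<Rightarrow> real \<times> (real ^ 'd)) \<Rightarrow> real ^ 'd \<Rightarrow> bool" where
  "is_beta_hat n \<zeta> b \<longleftrightarrow>
     (invertible (emp_Q n \<zeta>) \<longrightarrow>
        b = matrix_inv (emp_Q n \<zeta>) *v emp_mean n \<zeta> (\<lambda>(y, z). y *\<^sub>R z))"

definition is_A_hat ::
  "nat \<Rightarrow> (nat \<Rightarrow> nat \<Rightarrow> real \<times> (real ^ 'd)) \<Rightarrow> (real ^ 'd \<Rightarrow> real ^ 'd) \<Rightarrow> bool" where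
  "is_A_hat n \<zeta> A \<longleftrightarrow>
     (invertible (emp_Q n \<zeta>) \<longrightarrow> (\<forall>x. A x = matrix_inv (emp_Q n \<zeta>) *v emp_M n \<zeta> x))"

definition is_r_hat :: "nat \<Rightarrow> (nat \<Rightarrow> nat \<Rightarrow> real \<times> (real ^ 'd)) \<Rightarrow> real ^ 'd \<Rightarrow>
    (nat \<Rightarrow> nat \<Rightarrow> real ^ 'd \<Rightarrow> real) \<Rightarrow> bool" where
  "is_r_hat n \<zeta> b r \<longleftrightarrow>
     (invertible (emp_Q n \<zeta>) \<longrightarrow>
        (\<forall>(i, j)\<in>dyads n. \<forall>x. r i j x =
           (fst (\<zeta> i j) - snd (\<zeta> i j) \<bullet> b) *
           (of_bool (snd (\<zeta> i j) \<le> x) - emp_M n \<zeta> x \<bullet> (matrix_inv (emp_Q n \<zeta>) *v snd (\<zeta> i j)))))"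

end

theory Submission
  imports Defs
begin

text \<open>
  The only empirical process in the class is that of the orthants \<open>{z. z \<preceq> x}\<close>. The symmetric difference
  of two orthants is covered by \<open>d\<close> slabs, so both the uniform covering numbers and the uniform law
  of large numbers for \<open>M\<^sub>n\<close> reduce to one-dimensional half-lines, which form a chain; no
  Vapnik-Chervonenkis theory is needed. All other parameters enter through inner products and are
  controlled by a Euclidean grid.

  Dyads without a common node are independent, so dyadic averages have variance \<open>O(1/n)\<close>, and
  \<open>Q\<^sub>n\<close>, \<open>P\<^sub>n(XY)\<close> and, through finitely many brackets, \<open>M\<^sub>n\<close> are consistent. Hence \<open>b = \<beta>\<^sub>n\<close> and
  \<open>a = A\<^sub>n(x)\<close> are uniformly close to \<open>\<beta>\<^sub>*\<close> and \<open>Q\<^sup>-\<^sup>1M(x)\<close>, at which the deviation vanishes, and the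
  deviation is Lipschitz in \<open>(a, b)\<close> with factor proportional to \<open>1 + |y|\<close>.
\<close>

subsection \<open>Dyadic arrays\<close>

text \<open>Two obstacles shape the argument. First, the law of X may have atoms, so M is continuous
  from above but need not be continuous, and no modulus of continuity in x is available. Hence the
  brackets leave out the point at which a distribution function could jump, and the net does not
  discretise x: x enters only through the numbers L(z_k \<le> x_k) and the vector Q^{-1}M(x), which
  are treated as further grid coordinates. Second, L has just a second moment of y, so an indicator
  difference multiplied by y could not be controlled in L_2(L) by the plain distribution functions
  of z. In h - r the outcome cancels from the coefficient of the indicator, (y - z'b) - (y -
  z'\<beta>) = z'(\<beta> - b), and what remains is bounded; this is the point of passing to
  \<open>dev\<close>. The exponent 8d is 2 * 4d: four groups of d grid coordinates, and a factor two
  from a mesh of order \<epsilon>^2. Probabilities are taken of measurable inner events throughout,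
  so the measurability of a supremum over x never comes up.\<close>

lemma (in prob_space) distr_Pair_indep_set:
  assumes X[measurable]: "X \<in> measurable M S" and Y[measurable]: "Y \<in> measurable M T"
    and ind: "indep_set {X -` A \<inter> space M | A. A \<in> sets S} {Y -` B \<inter> space M | B. B \<in> sets T}"
  shows "distr M (S \<Otimes>\<^sub>M T) (\<lambda>w. (X w, Y w)) = distr M S X \<Otimes>\<^sub>M distr M T Y"
proof (rule pair_measure_eqI[symmetric])
  show "sigma_finite_measure (distr M S X)" "sigma_finite_measure (distr M T Y)"
    using prob_space_distr[OF X] prob_space_distr[OF Y] prob_space_imp_sigma_finite by auto
next
  show "sets (distr M S X \<Otimes>\<^sub>M distr M T Y) = sets (distr M (S \<Otimes>\<^sub>M T) (\<lambda>w. (X w, Y w)))"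
    by simp
next
  fix A B assume "A \<in> sets (distr M S X)" "B \<in> sets (distr M T Y)"
  then have [measurable]: "A \<in> sets S" "B \<in> sets T" by auto
  have "prob ((X -` A \<inter> space M) \<inter> (Y -` B \<inter> space M)) =
      prob (X -` A \<inter> space M) * prob (Y -` B \<inter> space M)"
    by (rule indep_setD[OF ind]) auto
  moreover have "(\<lambda>w. (X w, Y w)) -` (A \<times> B) \<inter> space M = (X -` A \<inter> space M) \<inter> (Y -` B \<inter> space M)"
    by auto
  ultimately show "emeasure (distr M S X) A * emeasure (distr M T Y) B =
      emeasure (distr M (S \<Otimes>\<^sub>M T) (\<lambda>w. (X w, Y w))) (A \<times> B)"
    by (simp add: emeasure_distr emeasure_eq_measure ennreal_mult' Int_ac)
qed

lemma Int_stable_vimages: "Int_stable {X -` A \<inter> \<Omega> | A. A \<in> sets S}"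
proof (rule Int_stableI)
  fix a b assume "a \<in> {X -` A \<inter> \<Omega> | A. A \<in> sets S}" "b \<in> {X -` A \<inter> \<Omega> | A. A \<in> sets S}"
  then obtain A B where "a = X -` A \<inter> \<Omega>" "b = X -` B \<inter> \<Omega>" "A \<in> sets S" "B \<in> sets S" by auto
  then have "a \<inter> b = X -` (A \<inter> B) \<inter> \<Omega>" "A \<inter> B \<in> sets S" by auto
  then show "a \<inter> b \<in> {X -` A \<inter> \<Omega> | A. A \<in> sets S}" by blast
qed

locale dyadic_array = prob_space P for P :: "'w measure" +
  fixes NU :: "'u measure" and NV :: "'v measure"
    and U :: "nat \<Rightarrow> 'w \<Rightarrow> 'u" and V :: "nat \<Rightarrow> nat \<Rightarrow> 'w \<Rightarrow> 'v"
    and N :: "'z measure" and \<tau> :: "'u \<Rightarrow> 'u \<Rightarrow> 'v \<Rightarrow> 'z"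
    and Z :: "nat \<Rightarrow> nat \<Rightarrow> 'w \<Rightarrow> 'z"
  assumes iid: "iid_nodes_dyads P NU NV U V"
    and tau_measurable: "(\<lambda>(u, u', v). \<tau> u u' v) \<in> measurable (NU \<Otimes>\<^sub>M NU \<Otimes>\<^sub>M NV) N"
    and Z_eq: "\<And>i j \<omega>. 1 \<le> i \<Longrightarrow> i < j \<Longrightarrow> \<omega> \<in> space P \<Longrightarrow> Z i j \<omega> = \<tau> (U i \<omega>) (U j \<omega>) (V i j \<omega>)"
begin

definition gen_events :: "nat + nat \<times> nat \<Rightarrow> 'w set set" where
  "gen_events = case_sum (\<lambda>i. {U i -` A \<inter> space P | A. A \<in> sets NU})
                 (\<lambda>(i, j). {V i j -` A \<inter> space P | A. A \<in> sets NV})"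

definition index_set :: "(nat + nat \<times> nat) set" where
  "index_set = Inl ` {1..} \<union> Inr ` {(i, j). 1 \<le> i \<and> i < j}"

text \<open>A measure space that serves merely to carry the sigma-algebra generated by the variables
  indexed by \<open>I\<close>, so that dependence on these variables alone can be expressed by
  \<open>measurable\<close>.\<close>

definition joint_sigma :: "(nat + nat \<times> nat) set \<Rightarrow> 'w measure" where
  "joint_sigma I = sigma (space P) (\<Union>i\<in>I. gen_events i)"

lemma U_measurable: "1 \<le> i \<Longrightarrow> U i \<in> measurable P NU"
  and distr_U: "1 \<le> i \<Longrightarrow> distr P NU (U i) = distr P NU (U 1)"
  and V_measurable: "1 \<le> i \<Longrightarrow> i < j \<Longrightarrow> V i j \<in> measurable P NV"
  and distr_V: "1 \<le> i \<Longrightarrow> i < j \<Longrightarrow> distr P NV (V i j) = distr P NV (V 1 2)"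
  and indep_gen: "indep_sets gen_events index_set"
  using iid unfolding iid_nodes_dyads_def indep_nodes_dyads_def gen_events_def index_set_def by blast+

lemma gen_events_Pow: "gen_events k \<subseteq> Pow (space P)"
  unfolding gen_events_def by (auto split: sum.splits prod.splits)

lemma space_joint_sigma: "space (joint_sigma I) = space P"
  and sets_joint_sigma: "sets (joint_sigma I) = sigma_sets (space P) (\<Union>i\<in>I. gen_events i)"
  unfolding joint_sigma_def using gen_events_Pow by (auto simp: space_measure_of sets_measure_of UN_least)

lemma Int_stable_gen_events: "Int_stable (gen_events k)"
  unfolding gen_events_def
  by (auto split: sum.splits prod.splits intro: Int_stable_vimages)

lemma U_joint_sigma:
  assumes "1 \<le> i" "Inl i \<in> I"
  shows "U i \<in> measurable (joint_sigma I) NU"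
proof (rule measurableI)
  fix A assume "A \<in> sets NU"
  then have "U i -` A \<inter> space P \<in> gen_events (Inl i)" by (auto simp: gen_events_def)
  with assms show "U i -` A \<inter> space (joint_sigma I) \<in> sets (joint_sigma I)"
    unfolding space_joint_sigma sets_joint_sigma by (blast intro: sigma_sets.Basic)
qed (use assms measurable_space[OF U_measurable] in \<open>auto simp: space_joint_sigma\<close>)

lemma V_joint_sigma:
  assumes "1 \<le> i" "i < j" "Inr (i, j) \<in> I"
  shows "V i j \<in> measurable (joint_sigma I) NV"
proof (rule measurableI)
  fix A assume "A \<in> sets NV"
  then have "V i j -` A \<inter> space P \<in> gen_events (Inr (i, j))" by (auto simp: gen_events_def)
  with assms show "V i j -` A \<inter> space (joint_sigma I) \<in> sets (joint_sigma I)"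
    unfolding space_joint_sigma sets_joint_sigma by (blast intro: sigma_sets.Basic)
qed (use assms measurable_space[OF V_measurable] in \<open>auto simp: space_joint_sigma\<close>)

text \<open>Grouping principle: the generating families are closed under intersection, so
  independence passes to the sigma-algebras of disjoint blocks. Below, independence is always read
  off from disjointness of index sets.\<close>

lemma indep_joint_sigma:
  assumes "I \<subseteq> index_set" "J \<subseteq> index_set" "I \<inter> J = {}"
  shows "indep_set (sets (joint_sigma I)) (sets (joint_sigma J))"
proof -
  have "indep_sets (\<lambda>b. sigma_sets (space P) (\<Union>i\<in>case_bool I J b. gen_events i)) UNIV"
  proof (rule indep_sets_collect_sigma)
    show "indep_sets gen_events (\<Union>b\<in>UNIV. case_bool I J b)"
      by (rule indep_sets_mono_index[OF _ indep_gen]) (use assms in \<open>auto split: bool.splits\<close>)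
    show "disjoint_family_on (case_bool I J) UNIV"
      using assms by (auto simp: disjoint_family_on_def split: bool.splits)
  qed (rule Int_stable_gen_events)
  then show ?thesis
    unfolding indep_set_def sets_joint_sigma
    by (rule indep_sets_mono_sets) (auto split: bool.split)
qed

lemma indep_set_vimages:
  assumes "I \<subseteq> index_set" "J \<subseteq> index_set" "I \<inter> J = {}"
    and X: "X \<in> measurable (joint_sigma I) S" and Y: "Y \<in> measurable (joint_sigma J) T"
  shows "indep_set {X -` A \<inter> space P | A. A \<in> sets S} {Y -` B \<inter> space P | B. B \<in> sets T}"
proof -
  have "{X -` A \<inter> space P | A. A \<in> sets S} \<subseteq> sets (joint_sigma I)"
    "{Y -` A \<inter> space P | A. A \<in> sets T} \<subseteq> sets (joint_sigma J)"
    using measurable_sets[OF X] measurable_sets[OF Y] by (auto simp: space_joint_sigma)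
  with indep_joint_sigma[OF assms(1-3)] show ?thesis
    unfolding indep_sets2_eq by blast
qed

definition dyad_vars :: "nat \<Rightarrow> nat \<Rightarrow> (nat + nat \<times> nat) set" where
  "dyad_vars i j = {Inl i, Inl j, Inr (i, j)}"

lemma Z_joint_sigma:
  assumes "1 \<le> i" "i < j"
  shows "Z i j \<in> measurable (joint_sigma (dyad_vars i j)) N"
proof -
  have [measurable]: "U i \<in> measurable (joint_sigma (dyad_vars i j)) NU"
      "U j \<in> measurable (joint_sigma (dyad_vars i j)) NU"
      "V i j \<in> measurable (joint_sigma (dyad_vars i j)) NV"
    using assms by (auto intro!: U_joint_sigma V_joint_sigma simp: dyad_vars_def)
  have "(\<lambda>\<omega>. (\<lambda>(u, u', v). \<tau> u u' v) (U i \<omega>, U j \<omega>, V i j \<omega>)) \<in> measurable (joint_sigma (dyad_vars i j)) N"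
    by (rule measurable_compose[OF _ tau_measurable]) measurable
  then show ?thesis
    by (rule measurable_cong[THEN iffD1, rotated]) (use Z_eq assms in \<open>auto simp: space_joint_sigma\<close>)
qed

text \<open>Splitting off one independent variable at a time gives a product law, and identical
  distribution makes it the same for every dyad; \<open>distr_Z\<close> pushes it forward along
  \<open>\<tau>\<close>.\<close>

lemma distr_triple:
  assumes "1 \<le> i" "i < j"
  shows "distr P (NU \<Otimes>\<^sub>M NU \<Otimes>\<^sub>M NV) (\<lambda>\<omega>. (U i \<omega>, U j \<omega>, V i j \<omega>)) =
    distr P NU (U 1) \<Otimes>\<^sub>M distr P NU (U 1) \<Otimes>\<^sub>M distr P NV (V 1 2)"
proof -
  have [measurable]: "U j \<in> measurable P NU" "U i \<in> measurable P NU" "V i j \<in> measurable P NV"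
    using assms by (auto intro!: U_measurable V_measurable)
  have [measurable]: "U j \<in> measurable (joint_sigma {Inl j, Inr (i, j)}) NU"
      "V i j \<in> measurable (joint_sigma {Inl j, Inr (i, j)}) NV"
    using assms by (auto intro!: U_joint_sigma V_joint_sigma)
  have 1: "distr P (NU \<Otimes>\<^sub>M NV) (\<lambda>\<omega>. (U j \<omega>, V i j \<omega>)) = distr P NU (U j) \<Otimes>\<^sub>M distr P NV (V i j)"
    using assms
    by (intro distr_Pair_indep_set indep_set_vimages[of "{Inl j}" "{Inr (i, j)}"] U_joint_sigma V_joint_sigma)
      (auto simp: index_set_def)
  have 2: "distr P (NU \<Otimes>\<^sub>M NU \<Otimes>\<^sub>M NV) (\<lambda>\<omega>. (U i \<omega>, U j \<omega>, V i j \<omega>)) =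
      distr P NU (U i) \<Otimes>\<^sub>M distr P (NU \<Otimes>\<^sub>M NV) (\<lambda>\<omega>. (U j \<omega>, V i j \<omega>))"
    using assms
    by (intro distr_Pair_indep_set indep_set_vimages[of "{Inl i}" "{Inl j, Inr (i, j)}"] U_joint_sigma)
      (auto simp: index_set_def)
  show ?thesis
    unfolding 2 1 using assms distr_U[of i] distr_U[of j] distr_V[of i j] by simp
qed

lemma Z_measurable:
  assumes "1 \<le> i" "i < j"
  shows "Z i j \<in> measurable P N"
proof -
  have [measurable]: "U j \<in> measurable P NU" "U i \<in> measurable P NU" "V i j \<in> measurable P NV"
    using assms by (auto intro!: U_measurable V_measurable)
  have "(\<lambda>\<omega>. (\<lambda>(u, u', v). \<tau> u u' v) (U i \<omega>, U j \<omega>, V i j \<omega>)) \<in> measurable P N"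
    by (rule measurable_compose[OF _ tau_measurable]) measurable
  then show ?thesis
    by (rule measurable_cong[THEN iffD1, rotated]) (use Z_eq assms in auto)
qed

lemma distr_Z:
  assumes "1 \<le> i" "i < j"
  shows "distr P N (Z i j) = distr P N (Z 1 2)"
proof -
  have *: "distr P N (Z i j) = distr (distr P NU (U 1) \<Otimes>\<^sub>M distr P NU (U 1) \<Otimes>\<^sub>M distr P NV (V 1 2)) N
      (\<lambda>(u, u', v). \<tau> u u' v)" if "1 \<le> i" "i < j" for i j
  proof -
    have [measurable]: "U j \<in> measurable P NU" "U i \<in> measurable P NU" "V i j \<in> measurable P NV"
      using that by (auto intro!: U_measurable V_measurable)
    have "distr P N (Z i j) = distr P N ((\<lambda>(u, u', v). \<tau> u u' v) \<circ> (\<lambda>\<omega>. (U i \<omega>, U j \<omega>, V i j \<omega>)))"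
      by (rule distr_cong) (use Z_eq that in auto)
    also have "\<dots> = distr (distr P (NU \<Otimes>\<^sub>M NU \<Otimes>\<^sub>M NV) (\<lambda>\<omega>. (U i \<omega>, U j \<omega>, V i j \<omega>))) N
      (\<lambda>(u, u', v). \<tau> u u' v)"
      by (rule distr_distr[OF tau_measurable, symmetric]) measurable
    finally show ?thesis unfolding distr_triple[OF that] .
  qed
  show ?thesis using *[OF assms] *[of 1 2] by simp
qed

lemma integrable_Z_iff:
  fixes f :: "'z \<Rightarrow> 'b::{banach, second_countable_topology}"
  assumes "1 \<le> i" "i < j" and f: "f \<in> borel_measurable N"
  shows "integrable P (\<lambda>\<omega>. f (Z i j \<omega>)) \<longleftrightarrow> integrable P (\<lambda>\<omega>. f (Z 1 2 \<omega>))"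
proof -
  have "integrable P (\<lambda>\<omega>. f (Z i j \<omega>)) \<longleftrightarrow> integrable (distr P N (Z i j)) f"
    by (rule integrable_distr_eq[symmetric]) (use assms Z_measurable in auto)
  also have "\<dots> \<longleftrightarrow> integrable (distr P N (Z 1 2)) f"
    by (simp only: distr_Z[OF assms(1,2)])
  also have "\<dots> \<longleftrightarrow> integrable P (\<lambda>\<omega>. f (Z 1 2 \<omega>))"
    by (rule integrable_distr_eq) (use f Z_measurable[of 1 2] in auto)
  finally show ?thesis .
qed

lemma expectation_Z:
  fixes f :: "'z \<Rightarrow> 'b::{banach, second_countable_topology}"
  assumes "1 \<le> i" "i < j" and f: "f \<in> borel_measurable N"
  shows "(\<integral>\<omega>. f (Z i j \<omega>) \<partial>P) = (\<integral>\<omega>. f (Z 1 2 \<omega>) \<partial>P)"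
proof -
  have "(\<integral>\<omega>. f (Z i j \<omega>) \<partial>P) = integral\<^sup>L (distr P N (Z i j)) f"
    by (rule integral_distr[symmetric]) (use assms Z_measurable in auto)
  also have "\<dots> = integral\<^sup>L (distr P N (Z 1 2)) f"
    by (simp only: distr_Z[OF assms(1,2)])
  also have "\<dots> = (\<integral>\<omega>. f (Z 1 2 \<omega>) \<partial>P)"
    by (rule integral_distr) (use f Z_measurable[of 1 2] in auto)
  finally show ?thesis .
qed

lemma sigma_sets_Z:
  assumes "1 \<le> i" "i < j"
  shows "sigma_sets (space P) {Z i j -` A \<inter> space P | A. A \<in> sets N} \<subseteq> sets (joint_sigma (dyad_vars i j))"
proof -
  have "{Z i j -` A \<inter> space P | A. A \<in> sets N} \<subseteq> sets (joint_sigma (dyad_vars i j))"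
    using measurable_sets[OF Z_joint_sigma[OF assms]] by (auto simp: space_joint_sigma)
  then show ?thesis
    using sets.sigma_sets_subset[of _ "joint_sigma (dyad_vars i j)"] by (simp add: space_joint_sigma)
qed

text \<open>\<open>Z i j\<close> is measurable for the sigma-algebra of
  \<open>dyad_vars i j\<close>. Disjoint node pairs also have different dyad indices, so the two
  blocks of variables are disjoint.\<close>

lemma indep_Z_disjoint:
  assumes "1 \<le> i" "i < j" "1 \<le> k" "k < l" "{i, j} \<inter> {k, l} = {}"
  shows "indep_var N (Z i j) N (Z k l)"
proof -
  have ind: "indep_set (sets (joint_sigma (dyad_vars i j))) (sets (joint_sigma (dyad_vars k l)))"
    by (rule indep_joint_sigma) (use assms in \<open>auto simp: dyad_vars_def index_set_def\<close>)
  show ?thesis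
    unfolding indep_var_eq
  proof (intro conjI Z_measurable assms)
    show "indep_set (sigma_sets (space P) {Z i j -` A \<inter> space P |A. A \<in> sets N})
     (sigma_sets (space P) {Z k l -` A \<inter> space P |A. A \<in> sets N})"
      using ind sigma_sets_Z[OF assms(1,2)] sigma_sets_Z[OF assms(3,4)]
      unfolding indep_sets2_eq by (meson subset_iff order_trans)
  qed
qed

end

subsection \<open>The weak law of large numbers for dyadic averages\<close>

lemma finite_dyads [simp]: "finite (dyads n)"
  by (rule finite_subset[of _ "{..n} \<times> {..n}"]) (auto simp: dyads_def)

lemma dyadsD: "p \<in> dyads n \<Longrightarrow> 1 \<le> fst p \<and> fst p < snd p \<and> snd p \<le> n"
  by (auto simp: dyads_def)

lemma card_dyads: "real (card (dyads n)) = real n * (real n - 1) / 2"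
proof (induction n)
  case 0
  have "dyads 0 = {}" by (auto simp: dyads_def)
  then show ?case by simp
next
  case (Suc n)
  have "dyads (Suc n) = dyads n \<union> (\<lambda>i. (i, Suc n)) ` {1..n}"
    by (auto simp: dyads_def)
  moreover have "dyads n \<inter> (\<lambda>i. (i, Suc n)) ` {1..n} = {}"
    by (auto simp: dyads_def)
  moreover have "card ((\<lambda>i. (i, Suc n)) ` {1..n}) = n"
    by (simp add: card_image inj_on_def)
  ultimately have "card (dyads (Suc n)) = card (dyads n) + n"
    by (simp add: card_Un_disjoint)
  with Suc show ?case by (simp add: field_simps)
qed

lemma emp_mean_card: "emp_mean n \<zeta> f = (1 / real (card (dyads n))) *\<^sub>R (\<Sum>p\<in>dyads n. f (\<zeta> (fst p) (snd p)))"
  unfolding emp_mean_def card_dyads by (simp add: case_prod_unfold)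

lemma emp_mean_diff: "emp_mean n \<zeta> (\<lambda>z. f z - g z) = emp_mean n \<zeta> f - emp_mean n \<zeta> g"
  unfolding emp_mean_card by (simp add: sum_subtractf scaleR_right_diff_distrib)

lemma emp_mean_linear: "linear h \<Longrightarrow> emp_mean n \<zeta> (\<lambda>z. h (f z)) = h (emp_mean n \<zeta> f)"
  unfolding emp_mean_card by (simp add: linear_sum linear_scale)

lemma norm_emp_mean_le:
  assumes "\<And>i j. (i, j) \<in> dyads n \<Longrightarrow> norm (f (\<zeta> i j)) \<le> g (\<zeta> i j)"
  shows "norm (emp_mean n \<zeta> f) \<le> emp_mean n \<zeta> g"
  unfolding emp_mean_card using assms
  by (auto intro!: divide_right_mono sum_norm_le)

text \<open>Each of the two nodes of \<open>p\<close> can be the first or the second entry of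
  \<open>q\<close>, with at most \<open>n\<close> partners: four families of size \<open>n\<close>.
  Against about n^2/2 dyads in all, this makes the variance of a dyadic mean of order 1/n.\<close>

lemma card_overlapping_dyads:
  "card {q \<in> dyads n. {fst p, snd p} \<inter> {fst q, snd q} \<noteq> {}} \<le> 4 * n"
proof -
  let ?A = "\<lambda>i. Pair i ` {1..n} \<union> (\<lambda>k. (k, i)) ` {1..n}"
  have A: "card (?A i) \<le> 2 * n" for i
    using card_Un_le[of "Pair i ` {1..n}" "(\<lambda>k. (k, i)) ` {1..n}"]
      card_image_le[of "{1..n}" "Pair i"] card_image_le[of "{1..n}" "\<lambda>k. (k, i)"] by simp
  have "{q \<in> dyads n. {fst p, snd p} \<inter> {fst q, snd q} \<noteq> {}} \<subseteq> ?A (fst p) \<union> ?A (snd p)"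
    by (auto simp: dyads_def image_iff)
  then have "card {q \<in> dyads n. {fst p, snd p} \<inter> {fst q, snd q} \<noteq> {}} \<le> card (?A (fst p) \<union> ?A (snd p))"
    by (rule card_mono[rotated]) auto
  also have "\<dots> \<le> card (?A (fst p)) + card (?A (snd p))"
    by (rule card_Un_le)
  also have "\<dots> \<le> 4 * n" using A[of "fst p"] A[of "snd p"] by linarith
  finally show ?thesis .
qed

section \<open>Calculus of statements that hold with probability tending to one\<close>

lemma with_prob_tending_to_1_mono:
  assumes "with_prob_tending_to_1 P \<Phi>" "\<And>n \<omega>. \<omega> \<in> space P \<Longrightarrow> \<Phi> n \<omega> \<Longrightarrow> \<Psi> n \<omega>"
  shows "with_prob_tending_to_1 P \<Psi>"
  using assms unfolding with_prob_tending_to_1_def by (meson sets.sets_into_space subset_iff)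

lemma (in prob_space) with_prob_tending_to_1_eventually:
  assumes "\<And>n. n \<ge> n0 \<Longrightarrow> (\<And>\<omega>. \<omega> \<in> space M \<Longrightarrow> \<Phi> n \<omega>)"
  shows "with_prob_tending_to_1 M \<Phi>"
  unfolding with_prob_tending_to_1_def
proof (intro exI[of _ "\<lambda>n. if n \<ge> n0 then space M else {}"] conjI allI)
  show "(\<lambda>n. measure M (if n0 \<le> n then space M else {})) \<longlonglongrightarrow> 1"
    by (rule Lim_transform_eventually[OF tendsto_const])
      (auto intro!: eventually_sequentiallyI[of n0] simp: prob_space)
qed (use assms in auto)

lemma (in prob_space) with_prob_tending_to_1_conj:
  assumes "with_prob_tending_to_1 M \<Phi>" "with_prob_tending_to_1 M \<Psi>"
  shows "with_prob_tending_to_1 M (\<lambda>n \<omega>. \<Phi> n \<omega> \<and> \<Psi> n \<omega>)"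
proof -
  obtain E where E: "\<And>n. E n \<in> events" "\<And>n \<omega>. \<omega> \<in> E n \<Longrightarrow> \<Phi> n \<omega>" "(\<lambda>n. prob (E n)) \<longlonglongrightarrow> 1"
    using assms(1) unfolding with_prob_tending_to_1_def by blast
  obtain F where F: "\<And>n. F n \<in> events" "\<And>n \<omega>. \<omega> \<in> F n \<Longrightarrow> \<Psi> n \<omega>" "(\<lambda>n. prob (F n)) \<longlonglongrightarrow> 1"
    using assms(2) unfolding with_prob_tending_to_1_def by blast
  \<comment> \<open>Bonferroni: inclusion-exclusion, with the probability of the union bounded by
    1.\<close>
  have *: "prob (E n) + prob (F n) - 1 \<le> prob (E n \<inter> F n)" for n
    using measure_Un3[of "E n" M "F n"] E(1) F(1) prob_le_1[of "E n \<union> F n"]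
    by (simp add: fmeasurable_eq_sets)
  have "(\<lambda>n. prob (E n \<inter> F n)) \<longlonglongrightarrow> 1"
  proof (rule tendsto_sandwich)
    show "\<forall>\<^sub>F n in sequentially. prob (E n) + prob (F n) - 1 \<le> prob (E n \<inter> F n)"
      using * by simp
    show "(\<lambda>n. prob (E n) + prob (F n) - 1) \<longlonglongrightarrow> 1"
      using tendsto_diff[OF tendsto_add[OF E(3) F(3)] tendsto_const[of 1]] by simp
  qed (auto intro!: tendsto_const)
  with E F show ?thesis
    unfolding with_prob_tending_to_1_def by (intro exI[of _ "\<lambda>n. E n \<inter> F n"]) auto
qed

lemma (in prob_space) with_prob_tending_to_1_ball_finite:
  assumes "finite I" "\<And>i. i \<in> I \<Longrightarrow> with_prob_tending_to_1 M (\<Phi> i)"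
  shows "with_prob_tending_to_1 M (\<lambda>n \<omega>. \<forall>i\<in>I. \<Phi> i n \<omega>)"
  using assms
proof (induction I)
  case empty
  then show ?case by (intro with_prob_tending_to_1_eventually) auto
next
  case (insert i I)
  then have "with_prob_tending_to_1 M (\<lambda>n \<omega>. \<Phi> i n \<omega> \<and> (\<forall>i\<in>I. \<Phi> i n \<omega>))"
    by (intro with_prob_tending_to_1_conj) auto
  then show ?case by simp
qed

context dyadic_array
begin

text \<open>Only the \<open>O(n\<^sup>3)\<close> pairs of dyads that share a node contribute to the second moment.\<close>

lemma second_moment_sum_dyads:
  assumes g[measurable]: "g \<in> borel_measurable N" and sq: "integrable P (\<lambda>\<omega>. (g (Z 1 2 \<omega>))\<^sup>2)"
    and zero: "(\<integral>\<omega>. g (Z 1 2 \<omega>) \<partial>P) = (0::real)"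
  shows "integrable P (\<lambda>\<omega>. (\<Sum>p\<in>dyads n. g (Z (fst p) (snd p) \<omega>))\<^sup>2)"
    and "(\<integral>\<omega>. (\<Sum>p\<in>dyads n. g (Z (fst p) (snd p) \<omega>))\<^sup>2 \<partial>P)
      \<le> real (card (dyads n)) * (4 * real n * (\<integral>\<omega>. (g (Z 1 2 \<omega>))\<^sup>2 \<partial>P))"
proof -
  define W where "W p \<omega> = g (Z (fst p) (snd p) \<omega>)" for p :: "nat \<times> nat" and \<omega>
  define s where "s = (\<integral>\<omega>. (g (Z 1 2 \<omega>))\<^sup>2 \<partial>P)"
  have g2: "(\<lambda>z. (g z)\<^sup>2) \<in> borel_measurable N" by measurable
  have W_meas: "W p \<in> borel_measurable P" if "p \<in> dyads n" for p
    unfolding W_def using measurable_compose[OF Z_measurable g] dyadsD[OF that] by auto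
  have W_sq: "integrable P (\<lambda>\<omega>. (W p \<omega>)\<^sup>2)" "(\<integral>\<omega>. (W p \<omega>)\<^sup>2 \<partial>P) = s" if "p \<in> dyads n" for p
    unfolding W_def s_def
    using integrable_Z_iff[OF _ _ g2, of "fst p" "snd p"] expectation_Z[OF _ _ g2, of "fst p" "snd p"]
      dyadsD[OF that] sq by auto
  have W_int: "integrable P (W p)" if "p \<in> dyads n" for p
    using square_integrable_imp_integrable[OF W_meas[OF that] W_sq(1)[OF that]] .
  have W_zero: "(\<integral>\<omega>. W p \<omega> \<partial>P) = 0" if "p \<in> dyads n" for p
    unfolding W_def using expectation_Z[OF _ _ g, of "fst p" "snd p"] dyadsD[OF that] zero by auto
  \<comment> \<open>Used twice in place of Cauchy-Schwarz: it makes the products integrable, and,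
    since all \<open>W p\<close> have the same second moment \<open>s\<close>, it bounds every mixed
    moment by \<open>s\<close>.\<close>
  have prod_le: "\<bar>a * b\<bar> \<le> (a\<^sup>2 + b\<^sup>2) / 2" for a b :: real
    using zero_le_power2[of "\<bar>a\<bar> - \<bar>b\<bar>"] by (simp add: power2_diff abs_mult)
  have WW: "integrable P (\<lambda>\<omega>. W p \<omega> * W q \<omega>)" if "p \<in> dyads n" "q \<in> dyads n" for p q
  proof (rule Bochner_Integration.integrable_bound)
    show "integrable P (\<lambda>\<omega>. ((W p \<omega>)\<^sup>2 + (W q \<omega>)\<^sup>2) / 2)"
      using W_sq that by auto
    show "AE \<omega> in P. norm (W p \<omega> * W q \<omega>) \<le> norm (((W p \<omega>)\<^sup>2 + (W q \<omega>)\<^sup>2) / 2)"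
      using prod_le by (auto intro!: AE_I2)
  qed (use W_meas that in auto)
  have WW_le: "(\<integral>\<omega>. W p \<omega> * W q \<omega> \<partial>P) \<le> s" if "p \<in> dyads n" "q \<in> dyads n" for p q
  proof -
    have "(\<integral>\<omega>. W p \<omega> * W q \<omega> \<partial>P) \<le> (\<integral>\<omega>. ((W p \<omega>)\<^sup>2 + (W q \<omega>)\<^sup>2) / 2 \<partial>P)"
    proof (rule integral_mono)
      show "W p \<omega> * W q \<omega> \<le> ((W p \<omega>)\<^sup>2 + (W q \<omega>)\<^sup>2) / 2" for \<omega>
        by (rule order_trans[OF abs_ge_self prod_le])
    qed (use WW W_sq that in auto)
    also have "\<dots> = s" using W_sq that by simp
    finally show ?thesis .
  qed
  have WW_zero: "(\<integral>\<omega>. W p \<omega> * W q \<omega> \<partial>P) = 0"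
    if "p \<in> dyads n" "q \<in> dyads n" "{fst p, snd p} \<inter> {fst q, snd q} = {}" for p q
  proof -
    have "indep_var N (Z (fst p) (snd p)) N (Z (fst q) (snd q))"
      by (rule indep_Z_disjoint) (use dyadsD that in auto)
    from indep_var_compose[OF this g g] have "indep_var borel (W p) borel (W q)"
      by (simp add: comp_def W_def[abs_def])
    from indep_var_lebesgue_integral[OF this W_int[OF that(1)] W_int[OF that(2)]]
    show ?thesis using W_zero that by simp
  qed
  have eq: "(\<Sum>p\<in>dyads n. g (Z (fst p) (snd p) \<omega>))\<^sup>2 = (\<Sum>p\<in>dyads n. \<Sum>q\<in>dyads n. W p \<omega> * W q \<omega>)" for \<omega>
    by (simp add: power2_eq_square sum_product W_def)
  show "integrable P (\<lambda>\<omega>. (\<Sum>p\<in>dyads n. g (Z (fst p) (snd p) \<omega>))\<^sup>2)"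
    unfolding eq using WW by auto
  have "(\<integral>\<omega>. (\<Sum>p\<in>dyads n. g (Z (fst p) (snd p) \<omega>))\<^sup>2 \<partial>P) =
      (\<Sum>p\<in>dyads n. \<Sum>q\<in>dyads n. \<integral>\<omega>. W p \<omega> * W q \<omega> \<partial>P)"
    unfolding eq using WW by (simp add: Bochner_Integration.integral_sum)
  also have "\<dots> \<le> (\<Sum>p\<in>dyads n. 4 * real n * s)"
  proof (rule sum_mono)
    fix p assume p: "p \<in> dyads n"
    let ?Q = "{q \<in> dyads n. {fst p, snd p} \<inter> {fst q, snd q} \<noteq> {}}"
    have "(\<Sum>q\<in>dyads n. \<integral>\<omega>. W p \<omega> * W q \<omega> \<partial>P) = (\<Sum>q\<in>?Q. \<integral>\<omega>. W p \<omega> * W q \<omega> \<partial>P)"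
      by (rule sum.mono_neutral_right) (use WW_zero p in auto)
    also have "\<dots> \<le> (\<Sum>q\<in>?Q. s)"
      by (rule sum_mono) (use WW_le p in auto)
    also have "\<dots> = real (card ?Q) * s" by simp
    also have "\<dots> \<le> (4 * real n) * s"
      using card_overlapping_dyads[of n p] by (intro mult_right_mono) (auto simp: s_def)
    finally show "(\<Sum>q\<in>dyads n. \<integral>\<omega>. W p \<omega> * W q \<omega> \<partial>P) \<le> 4 * real n * s" .
  qed
  finally show "(\<integral>\<omega>. (\<Sum>p\<in>dyads n. g (Z (fst p) (snd p) \<omega>))\<^sup>2 \<partial>P)
      \<le> real (card (dyads n)) * (4 * real n * (\<integral>\<omega>. (g (Z 1 2 \<omega>))\<^sup>2 \<partial>P))"
    by (simp add: s_def)
qed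

lemma emp_mean_measurable:
  fixes f :: "'z \<Rightarrow> 'b::{second_countable_topology, real_normed_vector}"
  assumes "f \<in> borel_measurable N"
  shows "(\<lambda>\<omega>. emp_mean n (\<lambda>i j. Z i j \<omega>) f) \<in> borel_measurable P"
  unfolding emp_mean_card
  using measurable_compose[OF Z_measurable assms] dyadsD
  by (intro borel_measurable_scaleR borel_measurable_const borel_measurable_sum) blast

text \<open>Chebyshev for the centred function \<open>g\<close>: with N_n = n(n-1)/2, the second
  moment of the mean is at most N_n * 4ns / N_n^2 = 8s/(n-1).\<close>

lemma weak_law_real:
  fixes f :: "'z \<Rightarrow> real"
  assumes f[measurable]: "f \<in> borel_measurable N" and sq: "integrable P (\<lambda>\<omega>. (f (Z 1 2 \<omega>))\<^sup>2)"
    and e: "0 < e"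
  shows "with_prob_tending_to_1 P
    (\<lambda>n \<omega>. \<bar>emp_mean n (\<lambda>i j. Z i j \<omega>) f - (\<integral>\<omega>. f (Z 1 2 \<omega>) \<partial>P)\<bar> < e)"
proof -
  define \<mu> where "\<mu> = (\<integral>\<omega>. f (Z 1 2 \<omega>) \<partial>P)"
  define g where "g z = f z - \<mu>" for z
  define s where "s = (\<integral>\<omega>. (g (Z 1 2 \<omega>))\<^sup>2 \<partial>P)"
  define X where "X n \<omega> = emp_mean n (\<lambda>i j. Z i j \<omega>) f - \<mu>" for n \<omega>
  have X[measurable]: "X n \<in> borel_measurable P" for n
    unfolding X_def using emp_mean_measurable[OF f] by auto
  have g[measurable]: "g \<in> borel_measurable N" unfolding g_def by measurable
  have f12: "(\<lambda>\<omega>. f (Z 1 2 \<omega>)) \<in> borel_measurable P"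
    using measurable_compose[OF Z_measurable f] by auto
  have int: "integrable P (\<lambda>\<omega>. f (Z 1 2 \<omega>))"
    by (rule square_integrable_imp_integrable[OF f12 sq])
  have gsq: "integrable P (\<lambda>\<omega>. (g (Z 1 2 \<omega>))\<^sup>2)"
    unfolding g_def power2_diff using sq int by auto
  have gz: "(\<integral>\<omega>. g (Z 1 2 \<omega>) \<partial>P) = 0"
    unfolding g_def using int by (simp add: \<mu>_def prob_space)
  \<comment> \<open>For n < 2 there are no dyads and the normalising constant vanishes; the limit
    ignores these n.\<close>
  have bound: "prob {\<omega> \<in> space P. e \<le> \<bar>X n \<omega>\<bar>} \<le> 8 * s / e\<^sup>2 / (real n - 1)" if n: "2 \<le> n" for n
  proof -
    have c: "real (card (dyads n)) > 0" using n by (simp add: card_dyads)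
    have X_eq: "X n \<omega> = (1 / real (card (dyads n))) * (\<Sum>p\<in>dyads n. g (Z (fst p) (snd p) \<omega>))" for \<omega>
      unfolding X_def g_def emp_mean_card sum_subtractf using c by (auto simp: field_simps diff_divide_distrib)
    have Xsq: "(X n \<omega>)\<^sup>2 = (1 / real (card (dyads n)))\<^sup>2 * (\<Sum>p\<in>dyads n. g (Z (fst p) (snd p) \<omega>))\<^sup>2" for \<omega>
      unfolding X_eq power_mult_distrib ..
    have i: "integrable P (\<lambda>\<omega>. (X n \<omega>)\<^sup>2)"
      unfolding Xsq using second_moment_sum_dyads(1)[OF g gsq gz, of n] by simp
    have "prob {\<omega> \<in> space P. e \<le> \<bar>X n \<omega>\<bar>} \<le> (\<integral>\<omega>. (X n \<omega>)\<^sup>2 \<partial>P) / e\<^sup>2"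
      by (rule second_moment_method) (use i e in auto)
    also have "(\<integral>\<omega>. (X n \<omega>)\<^sup>2 \<partial>P) \<le> (1 / real (card (dyads n)))\<^sup>2 * (real (card (dyads n)) * (4 * real n * s))"
      unfolding Xsq integral_mult_right_zero s_def
      by (intro mult_left_mono second_moment_sum_dyads(2)[OF g gsq gz, of n]) auto
    also have "\<dots> = 4 * real n * s / real (card (dyads n))"
      using c by (simp add: power2_eq_square)
    also have "\<dots> = 8 * s / (real n - 1)"
      using n by (simp add: card_dyads field_simps)
    finally show ?thesis using e by (simp add: divide_right_mono divide_divide_eq_left mult.commute)
  qed
  let ?E = "\<lambda>n. {\<omega> \<in> space P. \<bar>X n \<omega>\<bar> < e}"
  have "(\<lambda>n. prob (?E n)) \<longlonglongrightarrow> 1"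
  proof (rule tendsto_sandwich)
    show "\<forall>\<^sub>F n in sequentially. 1 - 8 * s / e\<^sup>2 / (real n - 1) \<le> prob (?E n)"
    proof (rule eventually_sequentiallyI)
      fix n :: nat assume "2 \<le> n"
      have "space P - {\<omega> \<in> space P. e \<le> \<bar>X n \<omega>\<bar>} = ?E n" by auto
      moreover have "{\<omega> \<in> space P. e \<le> \<bar>X n \<omega>\<bar>} \<in> events" by measurable
      ultimately have "prob (?E n) = 1 - prob {\<omega> \<in> space P. e \<le> \<bar>X n \<omega>\<bar>}"
        using prob_compl by metis
      with bound[OF \<open>2 \<le> n\<close>] show "1 - 8 * s / e\<^sup>2 / (real n - 1) \<le> prob (?E n)" by simp
    qed
    show "\<forall>\<^sub>F n in sequentially. prob (?E n) \<le> 1" by simp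
    have "filterlim (\<lambda>n. real n - 1) at_top sequentially"
      using filterlim_tendsto_add_at_top[OF tendsto_const[of "-1"] filterlim_real_sequentially]
      by (simp add: add.commute)
    then have "(\<lambda>n. 8 * s / e\<^sup>2 / (real n - 1)) \<longlonglongrightarrow> 0"
      by (intro tendsto_divide_0[OF tendsto_const] filterlim_at_top_imp_at_infinity)
    from tendsto_diff[OF tendsto_const[of 1] this]
    show "(\<lambda>n. 1 - 8 * s / e\<^sup>2 / (real n - 1)) \<longlonglongrightarrow> 1" by simp
  qed simp
  then show ?thesis
    unfolding with_prob_tending_to_1_def \<mu>_def[symmetric] X_def[symmetric]
    by (intro exI[of _ ?E]) auto
qed

theorem weak_law:
  fixes f :: "'z \<Rightarrow> 'b::euclidean_space"
  assumes f[measurable]: "f \<in> borel_measurable N" and sq: "integrable P (\<lambda>\<omega>. (norm (f (Z 1 2 \<omega>)))\<^sup>2)"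
    and e: "0 < e"
  shows "with_prob_tending_to_1 P
    (\<lambda>n \<omega>. norm (emp_mean n (\<lambda>i j. Z i j \<omega>) f - (\<integral>\<omega>. f (Z 1 2 \<omega>) \<partial>P)) < e)"
proof -
  have Z[measurable]: "Z 1 2 \<in> measurable P N" by (rule Z_measurable) auto
  have nf: "integrable P (\<lambda>\<omega>. norm (f (Z 1 2 \<omega>)))"
    by (rule square_integrable_imp_integrable[OF _ sq]) measurable
  have fi: "integrable P (\<lambda>\<omega>. f (Z 1 2 \<omega>))"
    using nf by (rule integrable_norm_cancel) measurable
  \<comment> \<open>The tolerance is divided by the dimension because the norm will be bounded by
    the sum of the absolute coordinates.\<close>
  have "with_prob_tending_to_1 P (\<lambda>n \<omega>. \<forall>b\<in>Basis.
      \<bar>emp_mean n (\<lambda>i j. Z i j \<omega>) (\<lambda>z. f z \<bullet> b) - (\<integral>\<omega>. f (Z 1 2 \<omega>) \<bullet> b \<partial>P)\<bar> < e / real DIM('b))"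
  proof (intro with_prob_tending_to_1_ball_finite weak_law_real)
    fix b :: 'b assume b: "b \<in> Basis"
    show "integrable P (\<lambda>\<omega>. (f (Z 1 2 \<omega>) \<bullet> b)\<^sup>2)"
    proof (rule Bochner_Integration.integrable_bound[OF sq])
      have "(f z \<bullet> b)\<^sup>2 \<le> (norm (f z))\<^sup>2" for z
        using norm_nth_le[OF b, of "f z"] by (metis abs_norm_cancel power2_le_iff_abs_le norm_ge_zero real_norm_def)
      then show "AE \<omega> in P. norm ((f (Z 1 2 \<omega>) \<bullet> b)\<^sup>2) \<le> norm ((norm (f (Z 1 2 \<omega>)))\<^sup>2)"
        by (auto intro!: AE_I2)
    qed measurable
  qed (use e in auto)
  then show ?thesis
  proof (rule with_prob_tending_to_1_mono)
    fix n \<omega>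
    let ?D = "emp_mean n (\<lambda>i j. Z i j \<omega>) f - (\<integral>\<omega>. f (Z 1 2 \<omega>) \<partial>P)"
    assume H: "\<forall>b\<in>Basis. \<bar>emp_mean n (\<lambda>i j. Z i j \<omega>) (\<lambda>z. f z \<bullet> b) - (\<integral>\<omega>. f (Z 1 2 \<omega>) \<bullet> b \<partial>P)\<bar> < e / real DIM('b)"
    have "emp_mean n (\<lambda>i j. Z i j \<omega>) (\<lambda>z. f z \<bullet> b) - (\<integral>\<omega>. f (Z 1 2 \<omega>) \<bullet> b \<partial>P) = ?D \<bullet> b" for b
      using emp_mean_linear[OF bounded_linear.linear[OF bounded_linear_inner_left[of b]], of n "\<lambda>i j. Z i j \<omega>" f]
        integral_inner_left[of b, OF fi] by (simp add: inner_diff_left)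
    with H have "\<And>b. b \<in> Basis \<Longrightarrow> \<bar>?D \<bullet> b\<bar> < e / real DIM('b)" by metis
    then have "(\<Sum>b\<in>Basis. \<bar>?D \<bullet> b\<bar>) < (\<Sum>b\<in>(Basis::'b set). e / real DIM('b))"
      by (intro sum_strict_mono) auto
    then show "norm ?D < e"
      using norm_le_l1[of ?D] by simp
  qed
qed

end

subsection \<open>Perturbed linear systems\<close>

text \<open>Here \<open>norm A\<close> is the Frobenius norm, the one in which
  \<open>weak_law\<close> controls the error of \<open>emp_Q\<close>. Cauchy-Schwarz is applied row
  by row.\<close>

lemma norm_matrix_vector_mult_le: "norm (A *v x) \<le> norm A * norm x" for A :: "real^'n^'m"
proof -
  have "norm (A *v x) = L2_set (\<lambda>i. \<bar>A $ i \<bullet> x\<bar>) UNIV"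
    by (simp add: norm_vec_def matrix_mult_dot)
  also have "\<dots> \<le> L2_set (\<lambda>i. norm (A $ i) * norm x) UNIV"
    by (rule L2_set_mono) (auto simp: Cauchy_Schwarz_ineq2)
  also have "\<dots> = norm A * norm x"
    by (simp add: norm_vec_def[of A] L2_set_left_distrib)
  finally show ?thesis .
qed

lemma matrix_inv_vector_cancel:
  fixes Q :: "real^'d^'d"
  assumes "invertible Q"
  shows "Q *v (matrix_inv Q *v v) = v" "matrix_inv Q *v (Q *v v) = v"
proof -
  have "\<exists>A'. Q ** A' = mat 1 \<and> A' ** Q = mat 1"
    using assms unfolding invertible_def by blast
  then have "Q ** matrix_inv Q = mat 1 \<and> matrix_inv Q ** Q = mat 1"
    unfolding matrix_inv_def by (rule someI_ex)
  then show "Q *v (matrix_inv Q *v v) = v" "matrix_inv Q *v (Q *v v) = v"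
    by (simp_all add: matrix_vector_mul_assoc)
qed

lemma inner_symmetric_matrix:
  fixes Q :: "real^'d^'d"
  assumes "transpose Q = Q"
  shows "(Q *v u) \<bullet> v = u \<bullet> (Q *v v)"
  by (metis assms dot_lmul_matrix vector_transpose_matrix)

text \<open>Turns M(x)'Q^{-1}z into the inner product of z with Q^{-1}M(x). This brings both the
  population and the estimated weights into the form a'z of \<open>h_fun\<close>.\<close>

lemma inner_matrix_inv_symmetric:
  fixes Q :: "real^'d^'d"
  assumes "invertible Q" "transpose Q = Q"
  shows "m \<bullet> (matrix_inv Q *v z) = (matrix_inv Q *v m) \<bullet> z"
  using inner_symmetric_matrix[OF assms(2), of "matrix_inv Q *v m" "matrix_inv Q *v z"]
  by (simp add: matrix_inv_vector_cancel[OF assms(1)])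

lemma invertible_bounded_below:
  fixes Q :: "real^'d^'d"
  assumes "0 < \<kappa>" "\<And>v. \<kappa> * norm v \<le> norm (Q *v v)"
  shows "invertible Q" "norm (matrix_inv Q *v w) \<le> norm w / \<kappa>"
proof -
  have "\<forall>v. Q *v v = 0 \<longrightarrow> v = 0"
  proof (intro allI impI)
    fix v assume "Q *v v = 0"
    with assms(2)[of v] have "\<kappa> * norm v \<le> 0" by simp
    with assms(1) show "v = 0" by (simp add: mult_le_0_iff)
  qed
  then show inv: "invertible Q"
    unfolding invertible_left_inverse matrix_left_invertible_ker .
  show "norm (matrix_inv Q *v w) \<le> norm w / \<kappa>"
    using assms(2)[of "matrix_inv Q *v w"] assms(1)
    by (simp add: matrix_inv_vector_cancel[OF inv] field_simps)
qed

text \<open>Half of the lower bound \<open>\<kappa>\<close> survives the perturbation, which gives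
  invertibility and bounds the inverse of \<open>R\<close> by 2/\<kappa>. Continuity of matrix
  inversion is replaced by an explicit estimate for the solutions.\<close>

lemma perturbed_linear_system:
  fixes Q R :: "real^'d^'d"
  assumes \<kappa>: "0 < \<kappa>" and Q: "\<And>v. \<kappa> * norm v \<le> norm (Q *v v)" and R: "norm (R - Q) \<le> \<kappa> / 2"
  shows "invertible R"
    and "norm (matrix_inv R *v m' - matrix_inv Q *v m) \<le> 2 / \<kappa> * (norm (m' - m) + norm (R - Q) * norm m / \<kappa>)"
proof -
  have low: "\<kappa> / 2 * norm v \<le> norm (R *v v)" for v
  proof -
    have "norm ((R - Q) *v v) \<le> \<kappa> / 2 * norm v"
      using norm_matrix_vector_mult_le[of "R - Q" v] mult_right_mono[OF R, of "norm v"] by simp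
    moreover have "norm (Q *v v) \<le> norm (R *v v) + norm ((R - Q) *v v)"
      using norm_triangle_ineq4[of "R *v v" "(R - Q) *v v"] by (simp add: matrix_vector_mult_diff_rdistrib)
    ultimately show ?thesis using Q[of v] by simp
  qed
  note inv = invertible_bounded_below[of "\<kappa> / 2" R, OF _ low] invertible_bounded_below[OF \<kappa> Q]
  show Rinv: "invertible R" using \<kappa> inv by simp
  define u where "u = matrix_inv Q *v m"
  have "norm u \<le> norm m / \<kappa>" using inv unfolding u_def by simp
  then have "norm (R - Q) * norm u \<le> norm (R - Q) * norm m / \<kappa>"
    by (metis mult_left_mono norm_ge_zero times_divide_eq_right)
  then have 1: "norm ((R - Q) *v u) \<le> norm (R - Q) * norm m / \<kappa>"
    using norm_matrix_vector_mult_le[of "R - Q" u] by linarith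
  have "Q *v u = m" unfolding u_def using inv by (simp add: matrix_inv_vector_cancel)
  \<comment> \<open>The solution \<open>u\<close> of the old system solves the new one up to the
    residual (R - Q)u, so the difference of the solutions solves a system in \<open>R\<close> with a
    small right-hand side.\<close>
  then have "matrix_inv R *v m' - u = matrix_inv R *v ((m' - m) - (R - Q) *v u)"
    by (simp add: matrix_vector_mult_diff_distrib matrix_vector_mult_diff_rdistrib matrix_inv_vector_cancel[OF Rinv])
  then have "norm (matrix_inv R *v m' - u) \<le> norm ((m' - m) - (R - Q) *v u) / (\<kappa> / 2)"
    using inv(2)[of "(m' - m) - (R - Q) *v u"] \<kappa> by simp
  also have "\<dots> \<le> (norm (m' - m) + norm (R - Q) * norm m / \<kappa>) / (\<kappa> / 2)"
    using \<kappa> 1 norm_triangle_ineq4[of "m' - m" "(R - Q) *v u"] by (intro divide_right_mono) auto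
  finally show "norm (matrix_inv R *v m' - matrix_inv Q *v m) \<le> 2 / \<kappa> * (norm (m' - m) + norm (R - Q) * norm m / \<kappa>)"
    unfolding u_def by (simp add: field_simps)
qed

subsection \<open>Brackets for half-lines and orthants\<close>

text \<open>The one-sided intervals decrease to the empty set because \<open>t\<close> itself is
  excluded, so continuity from above applies even if \<open>t\<close> is an atom.\<close>

lemma shrinking_intervals:
  fixes t :: real and M :: "real measure"
  assumes "finite_measure M" and M: "sets M = sets borel" and \<eta>: "0 < \<eta>"
  shows "\<exists>\<delta>>0. measure M {t - \<delta><..<t} \<le> \<eta> \<and> measure M {t<..<t + \<delta>} \<le> \<eta>"
proof -
  interpret finite_measure M by fact
  let ?A = "\<lambda>n::nat. {t - 1 / real (Suc n)<..<t}" and ?B = "\<lambda>n::nat. {t<..<t + 1 / real (Suc n)}"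
  have small: "\<exists>n. 1 / real (Suc n) < e" if "0 < e" for e :: real
    using reals_Archimedean[OF that] by (simp add: inverse_eq_divide)
  have le: "1 / real (Suc n) \<le> 1 / real (Suc m)" if "m \<le> n" for m n
    using that by (intro divide_left_mono) auto
  have "(\<lambda>n. measure M (?A n)) \<longlonglongrightarrow> measure M (\<Inter>n. ?A n)"
    by (rule Lim_measure_decseq) (use le M in \<open>force simp: antimono_def\<close>)+
  moreover have "(\<Inter>n. ?A n) = {}"
  proof (rule equals0I)
    fix s assume s: "s \<in> (\<Inter>n. ?A n)"
    then have "s < t" by auto
    then obtain n where "1 / real (Suc n) < t - s" using small[of "t - s"] by auto
    with s show False by (auto dest!: spec[of _ n])
  qed
  ultimately have "(\<lambda>n. measure M (?A n)) \<longlonglongrightarrow> 0" by simp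
  moreover have "(\<lambda>n. measure M (?B n)) \<longlonglongrightarrow> measure M (\<Inter>n. ?B n)"
    by (rule Lim_measure_decseq) (use le M in \<open>force simp: antimono_def\<close>)+
  moreover have "(\<Inter>n. ?B n) = {}"
  proof (rule equals0I)
    fix s assume s: "s \<in> (\<Inter>n. ?B n)"
    then have "t < s" by auto
    then obtain n where "1 / real (Suc n) < s - t" using small[of "s - t"] by auto
    with s show False by (auto dest!: spec[of _ n])
  qed
  ultimately have "\<forall>\<^sub>F n in sequentially. measure M (?A n) < \<eta> \<and> measure M (?B n) < \<eta>"
    using \<eta> by (intro eventually_conj order_tendstoD(2)[where y = 0]) auto
  then obtain n where "measure M (?A n) < \<eta> \<and> measure M (?B n) < \<eta>"
    unfolding eventually_sequentially by blast
  then show ?thesis by (intro exI[of _ "1 / real (Suc n)"]) auto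
qed

text \<open>Brackets in the sense of empirical processes, for the indicators of the sets {z. z \<le>
  x}. The order is left generic, so that half-lines and orthants are both instances.\<close>

definition brackets_on :: "'a::{ord, topological_space} measure \<Rightarrow> real \<Rightarrow> 'a set \<Rightarrow> ('a set \<times> 'a set) set \<Rightarrow> bool" where
  "brackets_on M \<eta> X \<B> \<longleftrightarrow> finite \<B> \<and>
     (\<forall>(L, H)\<in>\<B>. L \<in> sets borel \<and> H \<in> sets borel \<and> L \<subseteq> H \<and> measure M (H - L) \<le> \<eta>) \<and>
     (\<forall>x\<in>X. \<exists>(L, H)\<in>\<B>. L \<subseteq> {z. z \<le> x} \<and> {z. z \<le> x} \<subseteq> H)"

text \<open>Compactness replaces quantiles: around every \<open>t\<close> there is an interval on
  which two brackets suffice, and finitely many of these intervals cover.\<close>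

lemma half_line_brackets:
  fixes a b :: real and M :: "real measure"
  assumes "finite_measure M" and M: "sets M = sets borel" and \<eta>: "0 < \<eta>"
  shows "\<exists>\<B>. brackets_on M \<eta> {a..b} \<B>"
proof -
  interpret finite_measure M by fact
  obtain \<delta> where \<delta>: "\<And>t. 0 < \<delta> t" "\<And>t. measure M {t - \<delta> t<..<t} \<le> \<eta>" "\<And>t. measure M {t<..<t + \<delta> t} \<le> \<eta>"
    using shrinking_intervals[OF finite_measure_axioms M \<eta>] by metis
  have "compact {a..b}" by simp
  then obtain T where T: "finite T" "{a..b} \<subseteq> (\<Union>t\<in>T. {t - \<delta> t<..<t + \<delta> t})"
  proof (rule compactE_image[where C = UNIV])
    show "{a..b} \<subseteq> (\<Union>t\<in>UNIV. {t - \<delta> t<..<t + \<delta> t})" 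
    proof
      fix x assume "x \<in> {a..b}"
      show "x \<in> (\<Union>t\<in>UNIV. {t - \<delta> t<..<t + \<delta> t})" using \<delta>(1)[of x] by (intro UN_I[of x]) auto
    qed
  qed auto
  \<comment> \<open>The first kind of bracket serves x < t, the second x \<ge> t. The point
    \<open>t\<close> lies in neither difference, so an atom there costs nothing.\<close>
  let ?B = "(\<lambda>t. ({z. z \<le> t - \<delta> t}, {z. z < t})) ` T \<union> (\<lambda>t. ({z. z \<le> t}, {z. z < t + \<delta> t})) ` T"
  have d1: "{z. z < t} - {z. z \<le> t - \<delta> t} = {t - \<delta> t<..<t}" for t by auto
  have d2: "{z. z < t + \<delta> t} - {z. z \<le> t} = {t<..<t + \<delta> t}" for t by auto
  have "brackets_on M \<eta> {a..b} ?B"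
    unfolding brackets_on_def
  proof (intro conjI)
    show "\<forall>(L, H)\<in>?B. L \<in> sets borel \<and> H \<in> sets borel \<and> L \<subseteq> H \<and> measure M (H - L) \<le> \<eta>"
      using \<delta> by (auto simp: d1 d2 intro: less_trans le_less_trans)
    show "\<forall>x\<in>{a..b}. \<exists>(L, H)\<in>?B. L \<subseteq> {z. z \<le> x} \<and> {z. z \<le> x} \<subseteq> H"
    proof
      fix x assume "x \<in> {a..b}"
      with T obtain t where t: "t \<in> T" "t - \<delta> t < x" "x < t + \<delta> t" by auto
      show "\<exists>(L, H)\<in>?B. L \<subseteq> {z. z \<le> x} \<and> {z. z \<le> x} \<subseteq> H"
      proof (cases "x < t")
        case True
        with t show ?thesis by (intro bexI[of _ "({z. z \<le> t - \<delta> t}, {z. z < t})"]) auto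
      next
        case False
        with t show ?thesis by (intro bexI[of _ "({z. z \<le> t}, {z. z < t + \<delta> t})"]) auto
      qed
    qed
  qed (use T in auto)
  then show ?thesis by blast
qed

text \<open>Products of coordinate brackets. A point in the upper but not the lower box has some
  coordinate in a one-dimensional bracket gap, so a union bound over d slabs applies; hence the mass
  \<eta>/d for each coordinate.\<close>

lemma orthant_brackets:
  fixes lo hi :: "real^'d" and M :: "(real^'d) measure"
  assumes "finite_measure M" and M: "sets M = sets borel" and \<eta>: "0 < \<eta>"
  shows "\<exists>\<B>. brackets_on M \<eta> {lo..hi} \<B>"
proof -
  interpret finite_measure M by fact
  have nth: "(\<lambda>z. z $ k) \<in> borel_measurable M" for k
    by (subst measurable_cong_sets[OF M refl]) (intro borel_measurable_continuous_onI continuous_intros)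
  have "\<exists>\<B>. brackets_on (distr M borel (\<lambda>z. z $ k)) (\<eta> / CARD('d)) {lo $ k..hi $ k} \<B>" for k
  proof -
    interpret D: finite_measure "distr M borel (\<lambda>z. z $ k)" by (rule finite_measure_distr[OF nth])
    show ?thesis by (rule half_line_brackets[OF D.finite_measure_axioms]) (use \<eta> in auto)
  qed
  then obtain B where B: "\<And>k. brackets_on (distr M borel (\<lambda>z. z $ k)) (\<eta> / CARD('d)) {lo $ k..hi $ k} (B k)"
    by metis
  define \<Phi> :: "('d \<Rightarrow> real set \<times> real set) \<Rightarrow> (real^'d) set \<times> (real^'d) set" where
    "\<Phi> f = ({z. \<forall>k. z $ k \<in> fst (f k)}, {z. \<forall>k. z $ k \<in> snd (f k)})" for f
  have "brackets_on M \<eta> {lo..hi} (\<Phi> ` (Pi\<^sub>E UNIV B))"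
    unfolding brackets_on_def
  proof (intro conjI)
    show "finite (\<Phi> ` (Pi\<^sub>E UNIV B))"
      using B unfolding brackets_on_def by (intro finite_imageI finite_PiE) auto
    show "\<forall>(L, H)\<in>\<Phi> ` (Pi\<^sub>E UNIV B). L \<in> sets borel \<and> H \<in> sets borel \<and> L \<subseteq> H \<and> measure M (H - L) \<le> \<eta>"
    proof (clarsimp simp: \<Phi>_def, intro conjI)
      fix f assume f: "f \<in> Pi\<^sub>E UNIV B"
      have fk: "fst (f k) \<in> sets borel" "snd (f k) \<in> sets borel" "fst (f k) \<subseteq> snd (f k)"
        "measure (distr M borel (\<lambda>z. z $ k)) (snd (f k) - fst (f k)) \<le> \<eta> / CARD('d)" for k
        using B[of k] PiE_mem[OF f, of k] unfolding brackets_on_def by (auto simp: case_prod_unfold)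
      have box: "{z::real^'d. \<forall>k. z $ k \<in> A k} \<in> sets borel" if "\<And>k. A k \<in> sets borel" for A
      proof -
        have "(\<lambda>z::real^'d. z $ k) -` A k \<inter> space borel \<in> sets borel" for k
          by (rule measurable_sets[OF _ that]) (intro borel_measurable_continuous_onI continuous_intros)
        then have "(\<Inter>k. (\<lambda>z::real^'d. z $ k) -` A k \<inter> space borel) \<in> sets borel"
          by (intro sets.finite_INT) auto
        also have "(\<Inter>k. (\<lambda>z::real^'d. z $ k) -` A k \<inter> space borel) = {z. \<forall>k. z $ k \<in> A k}" by auto
        finally show ?thesis .
      qed
      show "{z. \<forall>k. z $ k \<in> fst (f k)} \<in> sets borel" "{z. \<forall>k. z $ k \<in> snd (f k)} \<in> sets borel"
        using fk by (auto intro!: box)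
      show "{z. \<forall>k. z $ k \<in> fst (f k)} \<subseteq> {z. \<forall>k. z $ k \<in> snd (f k)}" using fk(3) by blast
      have slab: "(\<lambda>z::real^'d. z $ k) -` (snd (f k) - fst (f k)) \<inter> space M \<in> sets M" for k
        by (rule measurable_sets[OF nth]) (use fk in auto)
      have "measure M ({z. \<forall>k. z $ k \<in> snd (f k)} - {z. \<forall>k. z $ k \<in> fst (f k)}) \<le>
          measure M (\<Union>k\<in>UNIV. (\<lambda>z. z $ k) -` (snd (f k) - fst (f k)) \<inter> space M)"
      proof (rule finite_measure_mono)
        show "(\<Union>k\<in>UNIV. (\<lambda>z. z $ k) -` (snd (f k) - fst (f k)) \<inter> space M) \<in> sets M"
          using slab by (intro sets.finite_UN) auto
      qed (use sets_eq_imp_space_eq[OF M] in auto)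
      also have "\<dots> \<le> (\<Sum>k\<in>UNIV. measure M ((\<lambda>z. z $ k) -` (snd (f k) - fst (f k)) \<inter> space M))"
        by (rule measure_UNION_le) (use slab in auto)
      also have "\<dots> \<le> (\<Sum>k\<in>(UNIV::'d set). \<eta> / CARD('d))"
        using fk nth by (intro sum_mono) (simp add: measure_distr)
      also have "\<dots> = \<eta>" by simp
      finally show "measure M ({z. \<forall>k. z $ k \<in> snd (f k)} - {z. \<forall>k. z $ k \<in> fst (f k)}) \<le> \<eta>" .
    qed
    show "\<forall>x\<in>{lo..hi}. \<exists>(L, H)\<in>\<Phi> ` (Pi\<^sub>E UNIV B). L \<subseteq> {z. z \<le> x} \<and> {z. z \<le> x} \<subseteq> H"
    proof
      fix x assume "x \<in> {lo..hi}"
      then have "x $ k \<in> {lo $ k..hi $ k}" for k by (auto simp: less_eq_vec_def)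
      then have "\<exists>p\<in>B k. fst p \<subseteq> {z. z \<le> x $ k} \<and> {z. z \<le> x $ k} \<subseteq> snd p" for k
        using B[of k] unfolding brackets_on_def by (auto simp: case_prod_unfold)
      then obtain f where f: "\<And>k. f k \<in> B k" "\<And>k. fst (f k) \<subseteq> {z. z \<le> x $ k}" "\<And>k. {z. z \<le> x $ k} \<subseteq> snd (f k)"
        by metis
      have "f \<in> Pi\<^sub>E UNIV B" using f by auto
      then show "\<exists>(L, H)\<in>\<Phi> ` (Pi\<^sub>E UNIV B). L \<subseteq> {z. z \<le> x} \<and> {z. z \<le> x} \<subseteq> H"
        using f(2,3) by (intro bexI[OF _ imageI[of f]]) (force simp: \<Phi>_def less_eq_vec_def)+
    qed
  qed
  then show ?thesis by blast
qed

subsection \<open>Uniform covering numbers\<close>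

text \<open>The deviation \<open>d_fun\<close>, rearranged so that the indicator has a coefficient free of \<open>y\<close>;
  \<open>c\<close> stands for the vector that represents \<open>z \<mapsto> M(x)'Q\<^sup>-\<^sup>1z\<close>.\<close>

definition dev :: "real^'d \<Rightarrow> real^'d \<Rightarrow> real^'d \<Rightarrow> real^'d \<Rightarrow> real^'d \<Rightarrow> real \<times> (real^'d) \<Rightarrow> real" where
  "dev \<beta> x a c b p = of_bool (snd p \<le> x) * (snd p \<bullet> (\<beta> - b))
     + (fst p - snd p \<bullet> \<beta>) * (c \<bullet> snd p) - (fst p - snd p \<bullet> b) * (a \<bullet> snd p)"

lemma dev_self: "dev \<beta> x c c \<beta> p = 0"
  by (simp add: dev_def)

lemma abs_inner_le: "\<bar>u \<bullet> v\<bar> \<le> r * s" if "norm u \<le> r" "norm v \<le> s" for u v :: "'a::real_inner"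
  using Cauchy_Schwarz_ineq2[of u v] mult_mono[OF that] norm_ge_zero[of u] norm_ge_zero[of v] that(1)
  by (meson order_trans)

text \<open>Supplies the envelope, with C' = 4 R^2 C^2. As R and C are at least 1, products of lower
  degree are absorbed into R^2 C^2.\<close>

lemma dev_bound:
  assumes R: "1 \<le> R" "norm (snd p) \<le> R" and C: "1 \<le> C" "norm \<beta> \<le> C" "norm a \<le> C" "norm b \<le> C" "norm c \<le> C"
  shows "\<bar>dev \<beta> x a c b p\<bar> \<le> 4 * R\<^sup>2 * C\<^sup>2 * (1 + \<bar>fst p\<bar>)"
proof -
  have RC: "0 \<le> R * C" "1 \<le> R * C" "1 \<le> R" "0 \<le> R" "0 \<le> C" using R C mult_mono[of 1 R 1 C] by auto
  have zb: "\<bar>snd p \<bullet> b\<bar> \<le> R * C" "\<bar>snd p \<bullet> \<beta>\<bar> \<le> R * C" "\<bar>c \<bullet> snd p\<bar> \<le> R * C" "\<bar>a \<bullet> snd p\<bar> \<le> R * C"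
    using abs_inner_le[OF R(2)] abs_inner_le[OF _ R(2)] C by (auto simp: mult.commute[of R])
  have 1: "\<bar>of_bool (snd p \<le> x) * (snd p \<bullet> (\<beta> - b))\<bar> \<le> 2 * (R * C)"
    using zb by (auto simp: inner_diff_right abs_mult)
  have 2: "\<bar>(fst p - snd p \<bullet> \<beta>) * (c \<bullet> snd p)\<bar> \<le> (\<bar>fst p\<bar> + R * C) * (R * C)"
    unfolding abs_mult using zb RC by (intro mult_mono) auto
  have 3: "\<bar>(fst p - snd p \<bullet> b) * (a \<bullet> snd p)\<bar> \<le> (\<bar>fst p\<bar> + R * C) * (R * C)"
    unfolding abs_mult using zb RC by (intro mult_mono) auto
  have 4: "R * C \<le> (R * C) * (R * C)" using RC by (intro mult_le_cancel_left1[THEN iffD2]) auto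
  then have 5: "\<bar>fst p\<bar> * (R * C) \<le> \<bar>fst p\<bar> * ((R * C) * (R * C))" by (intro mult_left_mono) auto
  have "\<bar>dev \<beta> x a c b p\<bar> \<le> 2 * (R * C) + 2 * ((\<bar>fst p\<bar> + R * C) * (R * C))"
    unfolding dev_def using 1 2 3 by linarith
  also have "\<dots> = 2 * (R * C) + 2 * (\<bar>fst p\<bar> * (R * C)) + 2 * ((R * C) * (R * C))" by (simp add: algebra_simps)
  also have "\<dots> \<le> 4 * ((R * C) * (R * C)) + 4 * (\<bar>fst p\<bar> * ((R * C) * (R * C)))"
    using 4 5 RC by (smt (verit) mult_nonneg_nonneg abs_ge_zero)
  finally show ?thesis by (simp add: power2_eq_square algebra_simps)
qed

text \<open>The one estimate behind both main claims. In the covering bound it compares two members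
  of the class; in the consistency proof it compares the estimated member with the parameters at
  which the deviation is zero.\<close>

lemma dev_diff:
  assumes R: "1 \<le> R" "norm (snd p) \<le> R" and C: "1 \<le> C" "norm \<beta> \<le> C" "norm a' \<le> C" "norm b \<le> C"
  shows "\<bar>dev \<beta> x a c b p - dev \<beta> x' a' c' b' p\<bar> \<le> 2 * R\<^sup>2 * C\<^sup>2 *
    (\<bar>of_bool (snd p \<le> x) - of_bool (snd p \<le> x')\<bar> + (1 + \<bar>fst p\<bar>) * (norm (a - a') + norm (b - b') + norm (c - c')))"
proof -
  define i where "i = (of_bool (snd p \<le> x) :: real)"
  define i' where "i' = (of_bool (snd p \<le> x') :: real)"
  define K where "K = R\<^sup>2 * C\<^sup>2"
  let ?y = "\<bar>fst p\<bar>"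
  have RC: "0 \<le> R * C" "1 \<le> R * C" "0 \<le> R" "0 \<le> C" using R C mult_mono[of 1 R 1 C] by auto
  have KRC: "K = (R * C) * (R * C)" by (simp add: K_def power2_eq_square)
  have K1: "R * C \<le> K" unfolding KRC using RC by (intro mult_le_cancel_left1[THEN iffD2]) auto
  have "R * 1 \<le> R * C" by (rule mult_left_mono) (use C RC in auto)
  moreover have "R * (R * C) * 1 \<le> R * (R * C) * C" by (rule mult_left_mono) (use C RC in auto)
  then have "R * (R * C) \<le> K" unfolding KRC by (simp only: mult_ac mult_1_right)
  ultimately have RK: "R \<le> K" "R * (R * C) \<le> K" using K1 by auto
  \<comment> \<open>Telescoping arranged so that, outside differences, only \<open>\<beta>\<close>,
    \<open>b\<close> and \<open>a'\<close> occur among the vectors: those bounded by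
    \<open>C\<close>.\<close>
  have eq: "dev \<beta> x a c b p - dev \<beta> x' a' c' b' p =
      (i - i') * (snd p \<bullet> (\<beta> - b)) - i' * (snd p \<bullet> (b - b')) + (fst p - snd p \<bullet> \<beta>) * ((c - c') \<bullet> snd p)
      - (fst p - snd p \<bullet> b) * ((a - a') \<bullet> snd p) + (snd p \<bullet> (b - b')) * (a' \<bullet> snd p)"
    unfolding dev_def i_def i'_def by (simp add: inner_diff_left inner_diff_right algebra_simps)
  have zb: "\<bar>snd p \<bullet> b\<bar> \<le> R * C" "\<bar>snd p \<bullet> \<beta>\<bar> \<le> R * C" "\<bar>a' \<bullet> snd p\<bar> \<le> R * C"
    using abs_inner_le[OF R(2)] abs_inner_le[OF _ R(2)] C by (auto simp: mult.commute[of R])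
  have zd: "\<bar>snd p \<bullet> (b - b')\<bar> \<le> R * norm (b - b')" "\<bar>(a - a') \<bullet> snd p\<bar> \<le> norm (a - a') * R"
      "\<bar>(c - c') \<bullet> snd p\<bar> \<le> norm (c - c') * R"
    using R(2) by (auto intro!: abs_inner_le)
  have 1: "\<bar>(i - i') * (snd p \<bullet> (\<beta> - b))\<bar> \<le> 2 * K * \<bar>i - i'\<bar>"
  proof -
    have "\<bar>snd p \<bullet> (\<beta> - b)\<bar> \<le> 2 * K" using zb K1 by (simp add: inner_diff_right)
    then show ?thesis unfolding abs_mult by (subst mult.commute) (rule mult_right_mono, auto)
  qed
  have 2: "\<bar>i' * (snd p \<bullet> (b - b'))\<bar> \<le> K * norm (b - b')"
  proof -
    have "\<bar>i' * (snd p \<bullet> (b - b'))\<bar> \<le> R * norm (b - b')" using zd(1) RC by (auto simp: i'_def)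
    also have "\<dots> \<le> K * norm (b - b')" using RK by (intro mult_right_mono) auto
    finally show ?thesis .
  qed
  have yK: "(?y + R * C) * R \<le> K * (1 + ?y)"
  proof -
    have "(?y + R * C) * R = ?y * R + R * (R * C)" by (simp add: algebra_simps)
    also have "\<dots> \<le> ?y * K + K" using RK by (intro add_mono mult_left_mono) auto
    finally show ?thesis by (simp add: algebra_simps)
  qed
  have main: "\<bar>(fst p - u) * v\<bar> \<le> K * (1 + ?y) * t" if "\<bar>u\<bar> \<le> R * C" "\<bar>v\<bar> \<le> t * R" "0 \<le> t" for u v t
  proof -
    have "\<bar>(fst p - u) * v\<bar> \<le> (?y + R * C) * (t * R)"
      unfolding abs_mult using that RC by (intro mult_mono) auto
    also have "\<dots> = (?y + R * C) * R * t" by (simp add: algebra_simps)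
    also have "\<dots> \<le> K * (1 + ?y) * t" using yK that by (intro mult_right_mono) auto
    finally show ?thesis .
  qed
  have 3: "\<bar>(fst p - snd p \<bullet> \<beta>) * ((c - c') \<bullet> snd p)\<bar> \<le> K * (1 + ?y) * norm (c - c')"
    by (rule main) (use zb zd in auto)
  have 4: "\<bar>(fst p - snd p \<bullet> b) * ((a - a') \<bullet> snd p)\<bar> \<le> K * (1 + ?y) * norm (a - a')"
    by (rule main) (use zb zd in auto)
  have 5: "\<bar>(snd p \<bullet> (b - b')) * (a' \<bullet> snd p)\<bar> \<le> K * norm (b - b')"
  proof -
    have "\<bar>(snd p \<bullet> (b - b')) * (a' \<bullet> snd p)\<bar> \<le> (R * norm (b - b')) * (R * C)"
      unfolding abs_mult using zb zd RC by (intro mult_mono) auto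
    also have "\<dots> = R * (R * C) * norm (b - b')" by (simp add: algebra_simps)
    also have "\<dots> \<le> K * norm (b - b')" using RK by (intro mult_right_mono) auto
    finally show ?thesis .
  qed
  have K0: "0 \<le> K" by (simp add: K_def)
  have pos: "0 \<le> K * ?y * norm (b - b')" "0 \<le> K * (1 + ?y) * norm (c - c')" "0 \<le> K * (1 + ?y) * norm (a - a')"
    using K0 by (auto intro!: mult_nonneg_nonneg)
  have "\<bar>dev \<beta> x a c b p - dev \<beta> x' a' c' b' p\<bar> \<le> 2 * K * \<bar>i - i'\<bar> + 2 * (K * norm (b - b'))
      + K * (1 + ?y) * norm (c - c') + K * (1 + ?y) * norm (a - a')"
    unfolding eq using 1 2 3 4 5 by linarith
  also have "\<dots> \<le> 2 * K * \<bar>i - i'\<bar> + 2 * (K * (1 + ?y) * norm (b - b'))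
      + 2 * (K * (1 + ?y) * norm (c - c')) + 2 * (K * (1 + ?y) * norm (a - a'))"
    using pos by (simp add: algebra_simps)
  finally show ?thesis
    unfolding i_def i'_def K_def by (simp add: algebra_simps)
qed

text \<open>If just one of the two orthants contains \<open>z\<close>, then some coordinate of
  \<open>z\<close> is separated by the corresponding half-lines. This is the reduction from orthants
  to slabs.\<close>

lemma orthant_indicator_diff:
  fixes z x x' :: "real^'d"
  shows "\<bar>of_bool (z \<le> x) - of_bool (z \<le> x')\<bar> \<le> (\<Sum>k\<in>UNIV. \<bar>of_bool (z $ k \<le> x $ k) - of_bool (z $ k \<le> x' $ k)\<bar> :: real)"
proof (cases "z \<le> x \<longleftrightarrow> z \<le> x'")
  case True
  then show ?thesis by (simp add: sum_nonneg)
next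
  case False
  then obtain k where "(z $ k \<le> x $ k) \<noteq> (z $ k \<le> x' $ k)" by (auto simp: less_eq_vec_def)
  then have "1 = \<bar>of_bool (z $ k \<le> x $ k) - of_bool (z $ k \<le> x' $ k) :: real\<bar>" by auto
  also have "\<dots> \<le> (\<Sum>k\<in>UNIV. \<bar>of_bool (z $ k \<le> x $ k) - of_bool (z $ k \<le> x' $ k)\<bar>)"
    by (rule member_le_sum) auto
  finally show ?thesis using False by auto
qed

text \<open>Rounding each number to a cell of side \<eta> leaves at most 2B/\<eta> + 2 cells per
  coordinate. One representative is taken from every occupied cell, so the net lies inside
  \<open>A\<close> and inherits the bounds that hold there.\<close>

lemma finite_net:
  fixes \<Phi> :: "'p \<Rightarrow> 'k \<Rightarrow> real"
  assumes K: "finite K" and B: "\<And>p k. p \<in> A \<Longrightarrow> k \<in> K \<Longrightarrow> \<bar>\<Phi> p k\<bar> \<le> B" "0 \<le> B" and \<eta>: "0 < \<eta>"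
  shows "\<exists>R\<subseteq>A. finite R \<and> real (card R) \<le> (2 * B / \<eta> + 2) ^ card K \<and>
    (\<forall>p\<in>A. \<exists>q\<in>R. \<forall>k\<in>K. \<bar>\<Phi> p k - \<Phi> q k\<bar> \<le> \<eta>)"
proof -
  define cell where "cell p = restrict (\<lambda>k. \<lfloor>\<Phi> p k / \<eta>\<rfloor>) K" for p
  let ?I = "{\<lfloor>- B / \<eta>\<rfloor>..\<lfloor>B / \<eta>\<rfloor>}"
  have sub: "cell ` A \<subseteq> Pi\<^sub>E K (\<lambda>_. ?I)"
  proof (clarsimp simp: cell_def)
    fix p k assume "p \<in> A" "k \<in> K"
    from B(1)[OF this] have "- B \<le> \<Phi> p k" "\<Phi> p k \<le> B" by auto
    then have "- B / \<eta> \<le> \<Phi> p k / \<eta>" "\<Phi> p k / \<eta> \<le> B / \<eta>"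
      using \<eta> by (auto intro!: divide_right_mono simp del: divide_minus_left)
    then show "\<lfloor>- (B / \<eta>)\<rfloor> \<le> \<lfloor>\<Phi> p k / \<eta>\<rfloor> \<and> \<lfloor>\<Phi> p k / \<eta>\<rfloor> \<le> \<lfloor>B / \<eta>\<rfloor>"
      by (auto intro!: floor_mono)
  qed
  have fin: "finite (Pi\<^sub>E K (\<lambda>_. ?I))" using K by (intro finite_PiE) auto
  have cI: "real (card ?I) \<le> 2 * B / \<eta> + 2"
  proof -
    have "0 \<le> B / \<eta>" using B \<eta> by simp
    then have "real (card ?I) = real_of_int (\<lfloor>B / \<eta>\<rfloor> - \<lfloor>- B / \<eta>\<rfloor> + 1)"
      by (simp add: le_floor_iff floor_le_iff) linarith
    also have "\<dots> \<le> 2 * B / \<eta> + 2" by (simp, linarith)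
    finally show ?thesis .
  qed
  define R where "R = inv_into A cell ` (cell ` A)"
  have finR: "finite (cell ` A)" using finite_subset[OF sub fin] .
  have "card R \<le> card (cell ` A)" unfolding R_def by (rule card_image_le[OF finR])
  also have "\<dots> \<le> card (Pi\<^sub>E K (\<lambda>_. ?I))" by (rule card_mono[OF fin sub])
  also have "\<dots> = card ?I ^ card K" using K by (simp add: card_PiE)
  finally have "real (card R) \<le> real (card ?I) ^ card K" by (metis of_nat_le_iff of_nat_power)
  also have "\<dots> \<le> (2 * B / \<eta> + 2) ^ card K" using cI by (intro power_mono) auto
  finally have card: "real (card R) \<le> (2 * B / \<eta> + 2) ^ card K" .
  show ?thesis
  proof (intro exI[of _ R] conjI ballI card)
    show "R \<subseteq> A" unfolding R_def by (auto intro: inv_into_into)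
    show "finite R" unfolding R_def using finR by simp
    fix p assume p: "p \<in> A"
    let ?q = "inv_into A cell (cell p)"
    have "cell ?q = cell p" by (rule f_inv_into_f) (use p in auto)
    have "\<bar>\<Phi> p k - \<Phi> ?q k\<bar> \<le> \<eta>" if "k \<in> K" for k
    proof -
      have "\<lfloor>\<Phi> p k / \<eta>\<rfloor> = \<lfloor>\<Phi> ?q k / \<eta>\<rfloor>"
        using fun_cong[OF \<open>cell ?q = cell p\<close>, of k] that by (simp add: cell_def)
      then have "\<bar>\<Phi> p k / \<eta> - \<Phi> ?q k / \<eta>\<bar> \<le> 1" by linarith
      then show ?thesis using \<eta> by (simp add: diff_divide_distrib[symmetric] abs_divide field_simps)
    qed
    then show "\<exists>q\<in>R. \<forall>k\<in>K. \<bar>\<Phi> p k - \<Phi> q k\<bar> \<le> \<eta>"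
      using p unfolding R_def by blast
  qed
qed

text \<open>\<open>g\<close> stands for x \<mapsto> Q^{-1}M(x). Keeping it abstract isolates what is
  used of it: boundedness for covering numbers, continuity from above for pointwise
  measurability.\<close>

definition dev_class :: "real^'d \<Rightarrow> (real^'d \<Rightarrow> real^'d) \<Rightarrow> (real^'d) set \<Rightarrow> real \<Rightarrow> (real \<times> (real^'d) \<Rightarrow> real) set" where
  "dev_class \<beta> g X C = {dev \<beta> x a (g x) b | x a b. x \<in> X \<and> norm a \<le> C \<and> norm b \<le> C}"

lemma dev_measurable:
  fixes x :: "real^'d"
  shows "dev \<beta> x a c b \<in> borel_measurable borel"
proof -
  have "closed (snd -` {..x} :: (real \<times> (real^'d)) set)"
    by (intro closed_vimage closed_eucl_atMost continuous_intros)
  then have [measurable]: "{p. snd p \<le> x} \<in> sets (borel :: (real \<times> (real^'d)) measure)"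
    by (auto simp: vimage_def atMost_def intro: borel_closed)
  have "(\<lambda>p::real \<times> (real^'d). of_bool (snd p \<le> x) :: real) = indicator {p. snd p \<le> x}"
    by (auto simp: indicator_def)
  then have 1: "(\<lambda>p::real \<times> (real^'d). of_bool (snd p \<le> x) :: real) \<in> borel_measurable borel"
    by simp
  show ?thesis
    unfolding dev_def[abs_def]
    by (intro borel_measurable_add borel_measurable_diff borel_measurable_times 1
        borel_measurable_continuous_onI continuous_intros)
qed

text \<open>For nested sets the integrand has constant sign, so the L_1 distance of the indicators
  is a difference of two numbers. Hence half-lines with close values of a distribution function are
  close in L_1, whatever L is.\<close>

lemma integral_indicator_diff_nested:
  fixes A B :: "'a set"
  assumes "finite_measure M" "A \<in> sets M" "B \<in> sets M" "A \<subseteq> B \<or> B \<subseteq> A"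
  shows "integrable M (\<lambda>p. \<bar>indicator A p - indicator B p\<bar> :: real)"
    and "(\<integral>p. \<bar>indicator A p - indicator B p\<bar> \<partial>M) = \<bar>measure M A - measure M B\<bar>"
proof -
  interpret finite_measure M by fact
  have *: "integrable M (\<lambda>p. indicator B p - indicator A p :: real) \<and>
      (\<integral>p. indicator B p - indicator A p \<partial>M) = measure M B - measure M A" if "A \<in> sets M" "B \<in> sets M" for A B
    using that by (auto simp: Int_absorb2 sets.sets_into_space less_top[symmetric])
  have "(\<lambda>p. \<bar>indicator A p - indicator B p\<bar> :: real) = (\<lambda>p. indicator B p - indicator A p) \<and> measure M A \<le> measure M B
    \<or> (\<lambda>p. \<bar>indicator A p - indicator B p\<bar> :: real) = (\<lambda>p. indicator A p - indicator B p) \<and> measure M B \<le> measure M A"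
    using assms(4)
  proof (elim disjE)
    assume "A \<subseteq> B"
    then have "measure M A \<le> measure M B" using assms by (intro finite_measure_mono)
    with \<open>A \<subseteq> B\<close> show ?thesis by (intro disjI1) (auto simp: indicator_def fun_eq_iff)
  next
    assume "B \<subseteq> A"
    then have "measure M B \<le> measure M A" using assms by (intro finite_measure_mono)
    with \<open>B \<subseteq> A\<close> show ?thesis by (intro disjI2) (auto simp: indicator_def fun_eq_iff)
  qed
  then show "integrable M (\<lambda>p. \<bar>indicator A p - indicator B p\<bar> :: real)"
    and "(\<integral>p. \<bar>indicator A p - indicator B p\<bar> \<partial>M) = \<bar>measure M A - measure M B\<bar>"
    using *[OF assms(2,3)] *[OF assms(3,2)] by auto
qed

lemma norm_diff_le_coordinates:
  fixes a b :: "real^'d"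
  assumes "\<And>k. \<bar>a $ k - b $ k\<bar> \<le> \<eta>"
  shows "norm (a - b) \<le> real CARD('d) * \<eta>"
proof -
  have "norm (a - b) \<le> (\<Sum>k\<in>UNIV. \<bar>(a - b) $ k\<bar>)" by (rule norm_le_l1_cart)
  also have "\<dots> \<le> (\<Sum>k\<in>(UNIV::'d set). \<eta>)" using assms by (intro sum_mono) auto
  finally show ?thesis by simp
qed

text \<open>A member of the class is determined up to a small \<open>L\<^sub>2(L)\<close> error by the finitely many bounded
  numbers \<open>a\<^sub>k\<close>, \<open>b\<^sub>k\<close>, \<open>g(x)\<^sub>k\<close> and the marginal distribution functions of \<open>L\<close> at \<open>x\<^sub>k\<close>, so a grid of
  these numbers yields a net. The indicator enters through its \<open>L\<^sub>1\<close> distance, whence the mesh \<open>\<epsilon>\<^sup>2\<close>.\<close>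

theorem covering_number_dev_class:
  fixes \<beta> :: "real^'d" and S :: "(real \<times> (real^'d)) set"
  defines "D \<equiv> (\<lambda>R C (y, z :: real^'d). 4 * R\<^sup>2 * C\<^sup>2 * (1 + \<bar>y\<bar>))"
  assumes R: "1 \<le> R" "\<And>p. p \<in> S \<Longrightarrow> norm (snd p) \<le> R"
    and C: "1 \<le> C" "norm \<beta> \<le> C" "\<And>x. x \<in> X \<Longrightarrow> norm (g x) \<le> C"
    and L: "L \<in> prob_measures_L2 S (D R C)" and \<epsilon>: "0 < \<epsilon>" "\<epsilon> \<le> 1"
  shows "ereal_of_enat (covering_number (\<epsilon> * L2_norm L (D R C)) (dev_class \<beta> g X C) L)
    \<le> ereal ((sqrt (20 * C * (real CARD('d))\<^sup>2 + 2) / \<epsilon>) powr (8 * real CARD('d)))"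
proof -
  let ?d = "real CARD('d)"
  define K where "K = 4 * R\<^sup>2 * C\<^sup>2"
  define w where "w p = (1 + \<bar>fst p\<bar>)\<^sup>2" for p :: "real \<times> (real^'d)"
  define I where "I = (\<integral>p. w p \<partial>L)"
  \<comment> \<open>Chosen so that the errors add up to \<epsilon>^2: the indicators give at most d
    \<eta> \<le> d^2 \<eta>, the three vectors at most (3 d \<eta>)^2 \<le> 9 d^2 \<eta>, the latter
    because \<eta> \<le> 1.\<close>
  define \<eta> where "\<eta> = \<epsilon>\<^sup>2 / (10 * ?d\<^sup>2)"
  have K: "0 < K" using R C by (simp add: K_def)
  have d: "1 \<le> ?d" by (simp add: Suc_le_eq)
  have \<eta>: "0 < \<eta>" using \<epsilon> d by (simp add: \<eta>_def)
  have \<epsilon>2: "\<epsilon>\<^sup>2 \<le> 1" using \<epsilon> by (simp add: power_le_one)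
  have d2: "1 \<le> ?d\<^sup>2" using d by simp
  have \<eta>1: "\<eta> \<le> 1" 
  proof -
    have "\<epsilon>\<^sup>2 \<le> 10 * ?d\<^sup>2" using \<epsilon>2 d2 by linarith
    then show ?thesis using d by (simp add: \<eta>_def)
  qed
  have prob: "prob_space L" and sp: "space L = S" and st: "sets L = sets (restrict_space borel S)"
    and Dsq: "square_integrable L (D R C)"
    using L by (auto simp: prob_measures_L2_def)
  interpret prob_space L by (fact prob)
  have meas: "f \<in> borel_measurable L" if "f \<in> borel_measurable borel" for f :: "_ \<Rightarrow> real"
    using measurable_restrict_space1[OF that, of S] by (simp add: measurable_cong_sets[OF st refl])
  have w: "w \<in> borel_measurable L"
    unfolding w_def[abs_def] by (intro meas borel_measurable_continuous_onI continuous_intros)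
  have D2: "\<bar>D R C p\<bar>\<^sup>2 = K\<^sup>2 * w p" for p
    unfolding D_def K_def w_def by (simp add: case_prod_unfold power_mult_distrib)
  have wint: "integrable L w"
    using Dsq K unfolding square_integrable_def D2 by simp
  have norm_D: "L2_norm L (D R C) = sqrt (K\<^sup>2 * I)"
    unfolding L2_norm_def D2 I_def by simp
  \<comment> \<open>The weight \<open>w\<close> is at least 1 and L is a probability measure. The
    unweighted error of the indicators can therefore be charged to the squared envelope norm K^2
    I.\<close>
  have I: "1 \<le> I"
  proof -
    have "(\<integral>p. 1 \<partial>L) \<le> I" unfolding I_def
      by (rule integral_mono) (auto simp: wint w_def)
    then show ?thesis by (simp add: prob_space)
  qed
  define H where "H k t = {p \<in> S. snd p $ k \<le> t}" for k :: 'd and t :: real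
  have H: "H k t \<in> sets L" for k t
  proof -
    have "closed {p :: real \<times> (real^'d). snd p $ k \<le> t}"
      by (intro closed_Collect_le continuous_intros)
    then have "S \<inter> {p. snd p $ k \<le> t} \<in> sets (restrict_space borel S)"
      by (auto simp: sets_restrict_space)
    also have "S \<inter> {p. snd p $ k \<le> t} = H k t" by (auto simp: H_def)
    finally show ?thesis by (simp add: st)
  qed
  define A :: "((real^'d) \<times> (real^'d) \<times> (real^'d)) set" where "A = {(x, a, b). x \<in> X \<and> norm a \<le> C \<and> norm b \<le> C}"
  \<comment> \<open>The 4d grid coordinates: j = 0 gives the marginal distribution functions of L at
    x, j = 1, 2, 3 the entries of \<open>a\<close>, \<open>b\<close> and \<open>g x\<close>. All are
    bounded by \<open>C\<close>, the probabilities because C \<ge> 1.\<close>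
  define \<Phi> :: "(real^'d) \<times> (real^'d) \<times> (real^'d) \<Rightarrow> nat \<times> 'd \<Rightarrow> real" where
    "\<Phi> = (\<lambda>(x, a, b) (j, k). if j = 0 then prob (H k (x $ k)) else if j = 1 then a $ k
      else if j = 2 then b $ k else g x $ k)"
  have "\<exists>N\<subseteq>A. finite N \<and> real (card N) \<le> (2 * C / \<eta> + 2) ^ card ({..<4::nat} \<times> (UNIV::'d set)) \<and>
    (\<forall>p\<in>A. \<exists>q\<in>N. \<forall>k\<in>{..<4} \<times> UNIV. \<bar>\<Phi> p k - \<Phi> q k\<bar> \<le> \<eta>)"
  proof (rule finite_net)
    show "\<bar>\<Phi> p k\<bar> \<le> C" if "p \<in> A" "k \<in> {..<4} \<times> UNIV" for p k
    proof -
      have "\<bar>v $ i\<bar> \<le> C" if "norm v \<le> C" for v :: "real^'d" and i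
        using component_le_norm_cart[of v i] that by linarith
      moreover have "\<bar>prob E\<bar> \<le> C" for E using order_trans[OF prob_le_1 C(1), of E] by simp
      ultimately show ?thesis using that C by (auto simp: \<Phi>_def A_def)
    qed
  qed (use C \<eta> in auto)
  then obtain N where N: "N \<subseteq> A" "finite N" "real (card N) \<le> (2 * C / \<eta> + 2) ^ (4 * CARD('d))"
    "\<And>p. p \<in> A \<Longrightarrow> \<exists>q\<in>N. \<forall>k\<in>{..<4} \<times> UNIV. \<bar>\<Phi> p k - \<Phi> q k\<bar> \<le> \<eta>"
    by (auto simp: card_cartesian_product)
  define f where "f = (\<lambda>(x, a, b). dev \<beta> x a (g x) b)"
  have f_sq: "square_integrable L (f p)" if "p \<in> A" for p
  proof -
    have fm: "f p \<in> borel_measurable L"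
      unfolding f_def by (cases p) (auto intro: meas dev_measurable)
    have "integrable L (\<lambda>q. \<bar>f p q\<bar>\<^sup>2)"
    proof (rule Bochner_Integration.integrable_bound)
      show "integrable L (\<lambda>q. K\<^sup>2 * w q)" using wint by simp
      show "AE q in L. norm (\<bar>f p q\<bar>\<^sup>2) \<le> norm (K\<^sup>2 * w q)"
      proof (rule AE_I2)
        fix q assume "q \<in> space L"
        then have "\<bar>f p q\<bar> \<le> K * (1 + \<bar>fst q\<bar>)"
          using that C R(1) R(2)[of q] unfolding f_def A_def K_def sp by (auto intro!: dev_bound)
        then have "\<bar>f p q\<bar>\<^sup>2 \<le> (K * (1 + \<bar>fst q\<bar>))\<^sup>2" by (intro power_mono) auto
        then show "norm (\<bar>f p q\<bar>\<^sup>2) \<le> norm (K\<^sup>2 * w q)" by (simp add: w_def power_mult_distrib)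
      qed
    qed (use fm in measurable)
    with fm show ?thesis by (simp add: square_integrable_def)
  qed
  have close: "L2_norm L (\<lambda>r. f p r - f q r) < \<epsilon> * L2_norm L (D R C)"
    if p: "p \<in> A" and q: "q \<in> A" and pq: "\<And>k. k \<in> {..<4} \<times> UNIV \<Longrightarrow> \<bar>\<Phi> p k - \<Phi> q k\<bar> \<le> \<eta>" for p q
  proof -
    obtain x a b where px: "p = (x, a, b)" by (cases p)
    obtain x' a' b' where qx: "q = (x', a', b')" by (cases q)
    have G: "\<bar>prob (H k (x $ k)) - prob (H k (x' $ k))\<bar> \<le> \<eta>" for k
      using pq[of "(0, k)"] by (simp add: px qx \<Phi>_def)
    have "norm (a - a') \<le> ?d * \<eta>" "norm (b - b') \<le> ?d * \<eta>" "norm (g x - g x') \<le> ?d * \<eta>"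
      using pq[of "(1, _)"] pq[of "(2, _)"] pq[of "(3, _)"]
      by (auto simp: px qx \<Phi>_def intro!: norm_diff_le_coordinates)
    then have s: "norm (a - a') + norm (b - b') + norm (g x - g x') \<le> 3 * (?d * \<eta>)" by linarith
    define J where "J k r = \<bar>indicator (H k (x $ k)) r - indicator (H k (x' $ k)) r :: real\<bar>" for k r
    have nested: "H k s \<subseteq> H k t \<or> H k t \<subseteq> H k s" for k s t
      using linear[of s t] unfolding H_def by force
    have J: "integrable L (J k)" "(\<integral>r. J k r \<partial>L) \<le> \<eta>" for k
      using integral_indicator_diff_nested[OF finite_measure_axioms H H nested] G[of k] unfolding J_def by auto
    have pw: "\<bar>f p r - f q r\<bar>\<^sup>2 \<le> K\<^sup>2 / 2 * ((\<Sum>k\<in>UNIV. J k r) + w r * (3 * (?d * \<eta>))\<^sup>2)" if "r \<in> space L" for r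
    proof -
      define i where "i = \<bar>of_bool (snd r \<le> x) - of_bool (snd r \<le> x') :: real\<bar>"
      define u where "u = (1 + \<bar>fst r\<bar>) * (3 * (?d * \<eta>))"
      have "r \<in> S" using that sp by simp
      \<comment> \<open>An indicator difference is 0 or 1 in absolute value, so its squared L_2 norm
        is its L_1 norm.\<close>
      have i2: "i\<^sup>2 = i" by (simp add: i_def)
      have iJ: "i \<le> (\<Sum>k\<in>UNIV. J k r)"
      proof -
        have "indicator (H k t) r = (of_bool (snd r $ k \<le> t) :: real)" for k t
          using \<open>r \<in> S\<close> by (simp add: H_def indicator_def)
        then show ?thesis
          unfolding i_def J_def using orthant_indicator_diff[of "snd r" x x'] by simp
      qed
      have "\<bar>f p r - f q r\<bar> \<le> 2 * R\<^sup>2 * C\<^sup>2 * (i + (1 + \<bar>fst r\<bar>) * (norm (a - a') + norm (b - b') + norm (g x - g x')))"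
        unfolding f_def px qx i_def prod.case using R(1) R(2)[OF \<open>r \<in> S\<close>] C p q by (intro dev_diff) (auto simp: px qx A_def)
      also have "\<dots> \<le> 2 * R\<^sup>2 * C\<^sup>2 * (i + u)"
        unfolding u_def using s by (intro mult_left_mono add_left_mono) auto
      also have "\<dots> = K / 2 * (i + u)" by (simp add: K_def)
      finally have "\<bar>f p r - f q r\<bar>\<^sup>2 \<le> (K / 2 * (i + u))\<^sup>2" by (intro power_mono) auto
      also have "\<dots> = K\<^sup>2 / 4 * (i + u)\<^sup>2" by (simp add: power_mult_distrib power_divide)
      also have "\<dots> \<le> K\<^sup>2 / 4 * (2 * (i\<^sup>2 + u\<^sup>2))"
        using zero_le_power2[of "i - u"] by (intro mult_left_mono) (auto simp: power2_sum power2_diff)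
      also have "\<dots> = K\<^sup>2 / 2 * (i + u\<^sup>2)" by (simp add: i2)
      also have "\<dots> \<le> K\<^sup>2 / 2 * ((\<Sum>k\<in>UNIV. J k r) + u\<^sup>2)"
        using iJ by (intro mult_left_mono add_right_mono) auto
      also have "u\<^sup>2 = w r * (3 * (?d * \<eta>))\<^sup>2" by (simp add: u_def w_def power_mult_distrib)
      finally show ?thesis .
    qed
    have "(\<integral>r. \<bar>f p r - f q r\<bar>\<^sup>2 \<partial>L) \<le> (\<integral>r. K\<^sup>2 / 2 * ((\<Sum>k\<in>UNIV. J k r) + w r * (3 * (?d * \<eta>))\<^sup>2) \<partial>L)"
    proof (rule integral_mono_AE')
      show "integrable L (\<lambda>r. K\<^sup>2 / 2 * ((\<Sum>k\<in>UNIV. J k r) + w r * (3 * (?d * \<eta>))\<^sup>2))"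
        using J wint by auto
      show "AE r in L. \<bar>f p r - f q r\<bar>\<^sup>2 \<le> K\<^sup>2 / 2 * ((\<Sum>k\<in>UNIV. J k r) + w r * (3 * (?d * \<eta>))\<^sup>2)"
        by (rule AE_I2) (rule pw)
      show "AE r in L. 0 \<le> K\<^sup>2 / 2 * ((\<Sum>k\<in>UNIV. J k r) + w r * (3 * (?d * \<eta>))\<^sup>2)"
        by (intro AE_I2 mult_nonneg_nonneg add_nonneg_nonneg sum_nonneg) (auto simp: J_def w_def)
    qed
    also have "\<dots> = K\<^sup>2 / 2 * ((\<Sum>k\<in>UNIV. \<integral>r. J k r \<partial>L) + I * (3 * (?d * \<eta>))\<^sup>2)"
      using J wint by (simp add: I_def)
    also have "\<dots> \<le> K\<^sup>2 / 2 * (I * \<epsilon>\<^sup>2)"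
    proof (rule mult_left_mono)
      have "(\<Sum>k\<in>UNIV. \<integral>r. J k r \<partial>L) \<le> (\<Sum>k\<in>(UNIV::'d set). \<eta>)" using J by (intro sum_mono)
      also have "\<dots> = ?d * \<eta>" by simp
      also have "\<dots> \<le> ?d\<^sup>2 * \<eta>" using d \<eta> by (intro mult_right_mono) (auto simp: power2_eq_square)
      also have "\<dots> \<le> I * (?d\<^sup>2 * \<eta>)" using mult_right_mono[OF I, of "?d\<^sup>2 * \<eta>"] \<eta> by simp
      finally have 1: "(\<Sum>k\<in>UNIV. \<integral>r. J k r \<partial>L) \<le> I * (?d\<^sup>2 * \<eta>)" .
      have "(3 * (?d * \<eta>))\<^sup>2 = 9 * ?d\<^sup>2 * \<eta> * \<eta>" by (simp add: power2_eq_square)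
      also have "\<dots> \<le> 9 * ?d\<^sup>2 * \<eta>" using \<eta> \<eta>1 by (intro mult_left_le) auto
      finally have "I * (3 * (?d * \<eta>))\<^sup>2 \<le> I * (9 * ?d\<^sup>2 * \<eta>)" using I by (intro mult_left_mono) auto
      with 1 have "(\<Sum>k\<in>UNIV. \<integral>r. J k r \<partial>L) + I * (3 * (?d * \<eta>))\<^sup>2 \<le> I * (10 * ?d\<^sup>2 * \<eta>)"
        by (simp add: algebra_simps)
      also have "10 * ?d\<^sup>2 * \<eta> = \<epsilon>\<^sup>2" using d by (simp add: \<eta>_def)
      finally show "(\<Sum>k\<in>UNIV. \<integral>r. J k r \<partial>L) + I * (3 * (?d * \<eta>))\<^sup>2 \<le> I * \<epsilon>\<^sup>2" .
    qed simp
    \<comment> \<open>The spare factor 1/2 provides the strict inequality demanded by open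
      balls.\<close>
    also have "\<dots> < \<epsilon>\<^sup>2 * (K\<^sup>2 * I)" using K I \<epsilon> by (simp add: field_simps)
    finally have "L2_norm L (\<lambda>r. f p r - f q r) < sqrt (\<epsilon>\<^sup>2 * (K\<^sup>2 * I))"
      unfolding L2_norm_def by (rule real_sqrt_less_mono)
    also have "\<dots> = \<epsilon> * L2_norm L (D R C)"
      unfolding norm_D real_sqrt_mult[of "\<epsilon>\<^sup>2"] using \<epsilon> by simp
    finally show ?thesis .
  qed
  have F: "dev_class \<beta> g X C = f ` A"
  proof (intro set_eqI iffI)
    fix h assume "h \<in> dev_class \<beta> g X C"
    then obtain x a b where "h = dev \<beta> x a (g x) b" "x \<in> X" "norm a \<le> C" "norm b \<le> C"
      unfolding dev_class_def by blast
    then show "h \<in> f ` A" by (intro image_eqI[of _ _ "(x, a, b)"]) (auto simp: f_def A_def)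
  next
    fix h assume "h \<in> f ` A"
    then obtain x a b where "h = dev \<beta> x a (g x) b" "x \<in> X" "norm a \<le> C" "norm b \<le> C"
      by (auto simp: f_def A_def)
    then show "h \<in> dev_class \<beta> g X C" unfolding dev_class_def by blast
  qed
  have "covering_number (\<epsilon> * L2_norm L (D R C)) (dev_class \<beta> g X C) L \<le> enat (card (f ` N))"
    unfolding covering_number_def
  proof (rule INF_lower, intro CollectI conjI ballI)
    show "finite (f ` N)" using N by simp
    show "square_integrable L h" if "h \<in> f ` N" for h using that N f_sq by auto
    show "square_integrable L h" if "h \<in> dev_class \<beta> g X C" for h using that f_sq unfolding F by auto
    fix h assume "h \<in> dev_class \<beta> g X C"
    then obtain p where p: "p \<in> A" "h = f p" unfolding F by auto
    from N(4)[OF p(1)] obtain q where "q \<in> N" "\<forall>k\<in>{..<4} \<times> UNIV. \<bar>\<Phi> p k - \<Phi> q k\<bar> \<le> \<eta>" by blast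
    then show "\<exists>h'\<in>f ` N. L2_norm L (\<lambda>r. h r - h' r) < \<epsilon> * L2_norm L (D R C)"
      using close[OF p(1), of q] N(1) p(2) by blast
  qed
  also have "\<dots> \<le> enat (card N)" using card_image_le[OF N(2)] by simp
  finally have "ereal_of_enat (covering_number (\<epsilon> * L2_norm L (D R C)) (dev_class \<beta> g X C) L) \<le> ereal_of_enat (enat (card N))"
    by (simp only: ereal_of_enat_le_iff)
  also have "\<dots> = ereal (real (card N))" by simp
  also have "\<dots> \<le> ereal ((sqrt (20 * C * ?d\<^sup>2 + 2) / \<epsilon>) powr (8 * ?d))"
  proof -
    \<comment> \<open>Since 2C/\<eta> = 20 C d^2/\<epsilon>^2 and 2 \<le> 2/\<epsilon>^2, the number
      of cells per coordinate is at most (A0/\<epsilon>)^2; the square doubles the exponent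
      4d.\<close>
    define A0 where "A0 = sqrt (20 * C * ?d\<^sup>2 + 2)"
    have A0: "0 < A0" using C by (auto simp: A0_def intro!: add_nonneg_pos)
    have "2 * C / \<eta> + 2 = 20 * C * ?d\<^sup>2 / \<epsilon>\<^sup>2 + 2" by (simp add: \<eta>_def)
    also have "2 \<le> 2 / \<epsilon>\<^sup>2" using \<epsilon> \<epsilon>2 by (simp add: le_divide_eq)
    then have "20 * C * ?d\<^sup>2 / \<epsilon>\<^sup>2 + 2 \<le> 20 * C * ?d\<^sup>2 / \<epsilon>\<^sup>2 + 2 / \<epsilon>\<^sup>2" by simp
    also have "\<dots> = A0\<^sup>2 / \<epsilon>\<^sup>2" using C by (simp add: A0_def add_divide_distrib)
    also have "\<dots> = (A0 / \<epsilon>)\<^sup>2" by (simp add: power_divide)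
    finally have "(2 * C / \<eta> + 2) ^ (4 * CARD('d)) \<le> ((A0 / \<epsilon>)\<^sup>2) ^ (4 * CARD('d))"
      using C \<eta> by (intro power_mono) auto
    also have "\<dots> = (A0 / \<epsilon>) ^ (8 * CARD('d))" by (simp add: power_mult[symmetric])
    also have "\<dots> = (A0 / \<epsilon>) powr (8 * ?d)" using A0 \<epsilon> by (subst powr_realpow[symmetric]) auto
    finally show ?thesis using N(3) unfolding A0_def by simp
  qed
  finally show ?thesis .
qed

subsection \<open>Pointwise measurability\<close>

lemma countable_vec:
  assumes "\<And>k. countable (A k)"
  shows "countable {x :: 'a^'d. \<forall>k. x $ k \<in> A k}"
proof -
  have "countable (vec_lambda ` Pi\<^sub>E UNIV A)" by (intro countable_image countable_PiE) (use assms in auto)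
  moreover have "{x :: 'a^'d. \<forall>k. x $ k \<in> A k} \<subseteq> vec_lambda ` Pi\<^sub>E UNIV A"
  proof
    fix x :: "'a^'d" assume "x \<in> {x. \<forall>k. x $ k \<in> A k}"
    then show "x \<in> vec_lambda ` Pi\<^sub>E UNIV A" by (intro image_eqI[of _ _ "\<lambda>k. x $ k"]) auto
  qed
  ultimately show ?thesis by (rule countable_subset[rotated])
qed

text \<open>Approximation has to come from above, where the indicators are continuous. If x_k = hi_k
  there is no room above inside the rectangle, so hi_k joins the rationals as an admissible
  value.\<close>

lemma approx_from_above:
  fixes lo hi x :: "real^'d"
  assumes "x \<in> {lo..hi}"
  shows "\<exists>xs. (\<forall>m. xs m \<in> {lo..hi} \<and> x \<le> xs m \<and> (\<forall>k. xs m $ k \<in> \<rat> \<union> {hi $ k})) \<and> xs \<longlonglongrightarrow> x"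
proof -
  have "\<exists>q. q \<in> \<rat> \<union> {hi $ k} \<and> x $ k \<le> q \<and> q \<le> hi $ k \<and> q \<le> x $ k + 1 / real (Suc m)" for k m
  proof (cases "x $ k = hi $ k")
    case True
    then show ?thesis by (intro exI[of _ "hi $ k"]) auto
  next
    case False
    then have "x $ k < hi $ k" using assms by (auto simp: less_eq_vec_def order_less_le)
    then have "x $ k < min (hi $ k) (x $ k + 1 / real (Suc m))" by auto
    from Rats_dense_in_real[OF this] show ?thesis by (auto simp del: of_nat_Suc intro: less_imp_le)
  qed
  then obtain q where q: "\<And>k m. q k m \<in> \<rat> \<union> {hi $ k}" "\<And>k m. x $ k \<le> q k m" "\<And>k m. q k m \<le> hi $ k"
      "\<And>k m. q k m \<le> x $ k + 1 / real (Suc m)" by metis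
  have "(\<lambda>m. \<chi> k. q k m) \<longlonglongrightarrow> x"
  proof (rule vec_tendstoI)
    fix k
    have "(\<lambda>m. q k m) \<longlonglongrightarrow> x $ k"
    proof (rule tendsto_sandwich)
      show "\<forall>\<^sub>F m in sequentially. x $ k \<le> q k m" "\<forall>\<^sub>F m in sequentially. q k m \<le> x $ k + 1 / real (Suc m)"
        using q by (auto intro!: always_eventually simp del: of_nat_Suc)
      show "(\<lambda>m. x $ k + 1 / real (Suc m)) \<longlonglongrightarrow> x $ k"
        using tendsto_add[OF tendsto_const lim_1_over_n[THEN LIMSEQ_Suc]] by force
    qed (rule tendsto_const)
    then show "(\<lambda>m. (\<chi> k. q k m) $ k) \<longlonglongrightarrow> x $ k" by simp
  qed
  moreover have "lo $ k \<le> q k m" for k m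
    using q(2)[of k m] assms by (auto simp: less_eq_vec_def intro: order_trans)
  ultimately show ?thesis
    using q by (intro exI[of _ "\<lambda>m. \<chi> k. q k m"]) (auto simp: less_eq_vec_def)
qed

text \<open>A violated coordinate satisfies x_k < z_k strictly, so it stays violated along the
  sequence; a satisfied inequality persists by monotonicity. The indicators are thus eventually
  constant.\<close>

lemma tendsto_of_bool_le_from_above:
  fixes z x :: "real^'d"
  assumes "xs \<longlonglongrightarrow> x" "\<And>m. x \<le> xs m"
  shows "(\<lambda>m. of_bool (z \<le> xs m) :: real) \<longlonglongrightarrow> of_bool (z \<le> x)"
proof (rule Lim_transform_eventually[OF tendsto_const])
  show "\<forall>\<^sub>F m in sequentially. of_bool (z \<le> x) = (of_bool (z \<le> xs m) :: real)"
  proof (cases "z \<le> x")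
    case True
    then show ?thesis using order_trans[OF _ assms(2)] by auto
  next
    case False
    then obtain k where "x $ k < z $ k" by (auto simp: less_eq_vec_def not_le)
    with tendsto_vec_nth[OF assms(1), of k] have "\<forall>\<^sub>F m in sequentially. xs m $ k < z $ k"
      by (rule order_tendstoD)
    then show ?thesis
      by eventually_elim (use False in \<open>auto simp: less_eq_vec_def not_le dest: spec[of _ k]\<close>)
  qed
qed

text \<open>The countable subclass takes x with rational or extreme coordinates, and a, b in a
  countable dense subset of the ball of radius C; density within the ball keeps the approximants in
  the class.\<close>

theorem pointwise_measurable_dev_class:
  fixes lo hi :: "real^'d"
  assumes g: "\<And>x xs. x \<in> {lo..hi} \<Longrightarrow> (\<And>m. x \<le> xs m) \<Longrightarrow> xs \<longlonglongrightarrow> x \<Longrightarrow> (\<lambda>m. g (xs m)) \<longlonglongrightarrow> g x"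
  shows "pointwise_measurable_on S (dev_class \<beta> g {lo..hi} C)"
proof -
  obtain T :: "(real^'d) set" where T: "countable T" "T \<subseteq> cball 0 C" "cball 0 C \<subseteq> closure T"
    by (rule separable)
  define X0 where "X0 = {x. \<forall>k. x $ k \<in> \<rat> \<union> {hi $ k}} \<inter> {lo..hi}"
  have "countable X0" unfolding X0_def by (rule countable_Int1[OF countable_vec]) (auto simp: countable_rat)
  define G where "G = (\<lambda>(x, a, b). dev \<beta> x a (g x) b) ` (X0 \<times> T \<times> T)"
  show ?thesis
    unfolding pointwise_measurable_on_def
  proof (intro exI[of _ G] conjI ballI)
    show "countable G" unfolding G_def using T \<open>countable X0\<close> by (intro countable_image countable_SIGMA) auto
    show "G \<subseteq> dev_class \<beta> g {lo..hi} C" 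
    proof
      fix f assume "f \<in> G"
      then obtain x a b where "f = dev \<beta> x a (g x) b" "x \<in> {lo..hi}" "a \<in> T" "b \<in> T"
        by (auto simp: G_def X0_def)
      moreover from this have "a \<in> cball 0 C" "b \<in> cball 0 C" using T(2) by auto
      ultimately show "f \<in> dev_class \<beta> g {lo..hi} C" unfolding dev_class_def by auto
    qed
    fix f assume "f \<in> dev_class \<beta> g {lo..hi} C"
    then obtain x a b where f: "f = dev \<beta> x a (g x) b" "x \<in> {lo..hi}" "norm a \<le> C" "norm b \<le> C"
      by (auto simp: dev_class_def)
    from approx_from_above[OF f(2)] obtain xs where xs: "\<And>m. xs m \<in> {lo..hi}" "\<And>m. x \<le> xs m"
      "\<And>m k. xs m $ k \<in> \<rat> \<union> {hi $ k}" "xs \<longlonglongrightarrow> x" by blast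
    have "a \<in> closure T" "b \<in> closure T" using T(3) f by auto
    then obtain as bs where as: "\<And>m. as m \<in> T" "as \<longlonglongrightarrow> a" and bs: "\<And>m. bs m \<in> T" "bs \<longlonglongrightarrow> b"
      unfolding closure_sequential by blast
    show "\<exists>h. (\<forall>m. h m \<in> G) \<and> (\<forall>p\<in>S. (\<lambda>m. h m p) \<longlonglongrightarrow> f p)"
    proof (intro exI[of _ "\<lambda>m. dev \<beta> (xs m) (as m) (g (xs m)) (bs m)"] conjI allI ballI)
      show "dev \<beta> (xs m) (as m) (g (xs m)) (bs m) \<in> G" for m
        unfolding G_def using as bs xs by (intro image_eqI[of _ _ "(xs m, as m, bs m)"]) (auto simp: X0_def)
      show "(\<lambda>m. dev \<beta> (xs m) (as m) (g (xs m)) (bs m) p) \<longlonglongrightarrow> f p" for p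
        unfolding f(1) dev_def
        by (intro tendsto_intros tendsto_of_bool_le_from_above g xs f(2) as bs)
    qed
  qed
qed

subsection \<open>Uniform consistency\<close>

lemma orthant_set_measurable: "{z. z \<le> x} \<in> sets (borel :: (real^'d) measure)"
  using borel_closed[OF closed_eucl_atMost[of x]] by (simp add: atMost_def)

lemma measurable_snd_borel: "snd \<in> borel_measurable (borel :: ('a::topological_space \<times> 'b::topological_space) measure)"
  and measurable_fst_borel: "fst \<in> borel_measurable (borel :: ('a::topological_space \<times> 'b::topological_space) measure)"
  by (intro borel_measurable_continuous_onI continuous_intros)+

lemma indicator_snd_measurable:
  fixes B :: "(real^'d) set"
  assumes "B \<in> sets borel"
  shows "(\<lambda>p :: real \<times> (real^'d). indicator B (snd p) :: real) \<in> borel_measurable borel"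
  by (rule measurable_compose[OF measurable_snd_borel borel_measurable_indicator[OF assms]])

lemma outer_measurable: "(\<lambda>p :: real \<times> (real^'d). outer (snd p)) \<in> borel_measurable borel"
  unfolding outer_def[abs_def]
  by (intro borel_measurable_continuous_onI continuous_on_vec_lambda continuous_intros)

lemma norm_outer: "norm (outer z) = (norm z)\<^sup>2"
proof -
  have "outer z $ k = z $ k *\<^sub>R z" for k by (simp add: outer_def vec_eq_iff)
  then have "norm (outer z) = L2_set (\<lambda>k. norm (z $ k) * norm z) UNIV"
    unfolding norm_vec_def[of "outer z"] by simp
  also have "\<dots> = norm z * norm z"
    by (simp add: L2_set_left_distrib[symmetric] norm_vec_def)
  finally show ?thesis by (simp add: power2_eq_square)
qed

lemma transpose_outer: "transpose (outer z) = outer z"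
  by (simp add: outer_def transpose_def mult.commute)

lemma linear_transpose: "linear (transpose :: real^'n^'m \<Rightarrow> real^'m^'n)"
  by (rule linearI) (simp_all add: transpose_def vec_eq_iff)

text \<open>The bound \<open>R\<close> comes from the compact rectangle, so it holds at every sample
  point and no null sets have to be removed.\<close>

locale dyadic_regression = dyadic_array P NU NV U V borel \<tau> Z
  for P :: "'w measure" and NU :: "'u measure" and NV :: "'v measure" and U V
    and \<tau> :: "'u \<Rightarrow> 'u \<Rightarrow> 'v \<Rightarrow> real \<times> (real^'d)" and Z +
  fixes lo hi :: "real^'d" and R :: real
  assumes X_in: "\<And>i j \<omega>. 1 \<le> i \<Longrightarrow> i < j \<Longrightarrow> \<omega> \<in> space P \<Longrightarrow> snd (Z i j \<omega>) \<in> {lo..hi}"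
    and R: "1 \<le> R" "\<And>z. z \<in> {lo..hi} \<Longrightarrow> norm z \<le> R"
begin

lemma X_norm: "1 \<le> i \<Longrightarrow> i < j \<Longrightarrow> \<omega> \<in> space P \<Longrightarrow> norm (snd (Z i j \<omega>)) \<le> R"
  using X_in R by blast

lemma X_norm_dyads: "(i, j) \<in> dyads n \<Longrightarrow> \<omega> \<in> space P \<Longrightarrow> norm (snd (Z i j \<omega>)) \<le> R"
  using X_norm dyadsD[of "(i, j)" n] by simp

lemma Z12: "Z 1 2 \<in> borel_measurable P"
  by (rule Z_measurable) auto

lemma X12: "(\<lambda>\<omega>. snd (Z 1 2 \<omega>)) \<in> borel_measurable P"
  by (rule measurable_compose[OF Z12 measurable_snd_borel])

lemma integrable_bounded_sq:
  fixes f :: "real \<times> (real^'d) \<Rightarrow> 'b::{banach, second_countable_topology}"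
  assumes f: "f \<in> borel_measurable borel" and B: "\<And>p. snd p \<in> {lo..hi} \<Longrightarrow> norm (f p) \<le> B"
  shows "integrable P (\<lambda>\<omega>. f (Z 1 2 \<omega>))" "integrable P (\<lambda>\<omega>. (norm (f (Z 1 2 \<omega>)))\<^sup>2)"
proof -
  have fm[measurable]: "(\<lambda>\<omega>. f (Z 1 2 \<omega>)) \<in> borel_measurable P"
    by (rule measurable_compose[OF Z12 f])
  have fb: "norm (f (Z 1 2 \<omega>)) \<le> B" if "\<omega> \<in> space P" for \<omega>
    using B X_in[of 1 2] that by simp
  show "integrable P (\<lambda>\<omega>. f (Z 1 2 \<omega>))"
    by (rule integrable_const_bound[OF AE_I2 fm]) (rule fb)
  show "integrable P (\<lambda>\<omega>. (norm (f (Z 1 2 \<omega>)))\<^sup>2)"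
  proof (rule integrable_const_bound[OF AE_I2])
    show "norm ((norm (f (Z 1 2 \<omega>)))\<^sup>2) \<le> B\<^sup>2" if "\<omega> \<in> space P" for \<omega>
      using power_mono[OF fb[OF that], of 2] by simp
  qed measurable
qed

lemma indicator_X_bracket:
  fixes L H :: "(real^'d) set"
  assumes "L \<subseteq> {z. z \<le> x}" "{z. z \<le> x} \<subseteq> H" "norm z \<le> R"
  shows "norm (of_bool (z \<le> x) *\<^sub>R z - indicator L z *\<^sub>R z) \<le> R * indicator (H - L) z"
  using assms R(1) by (auto simp: indicator_def)

lemma outer_bound: "snd p \<in> {lo..hi} \<Longrightarrow> norm (outer (snd p)) \<le> R\<^sup>2"
  using R by (auto simp: norm_outer intro: power_mono)

theorem uniform_weak_law_M:
  assumes e: "0 < e"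
  shows "with_prob_tending_to_1 P
    (\<lambda>n \<omega>. \<forall>x\<in>{lo..hi}. norm (emp_M n (\<lambda>i j. Z i j \<omega>) x - pop_M P (Z 1 2) x) \<le> e)"
proof -
  \<comment> \<open>Error budget: R * 2\<eta> = e/2 for the bracket under the empirical measure, R *
    \<eta> = e/4 for the bracket under the population law, and e/4 for the weak law at L.\<close>
  define \<eta> where "\<eta> = e / (4 * R)"
  have \<eta>: "0 < \<eta>" using e R by (simp add: \<eta>_def)
  define \<nu> where "\<nu> = distr P borel (\<lambda>\<omega>. snd (Z 1 2 \<omega>))"
  have "finite_measure \<nu>" unfolding \<nu>_def by (rule finite_measure_distr[OF X12])
  from orthant_brackets[OF this _ \<eta>] obtain \<B> where "brackets_on \<nu> \<eta> {lo..hi} \<B>"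
    by (auto simp: \<nu>_def)
  then have fin: "finite \<B>"
    and LH: "\<And>L H. (L, H) \<in> \<B> \<Longrightarrow> L \<in> sets borel \<and> H \<in> sets borel \<and> L \<subseteq> H \<and> measure \<nu> (H - L) \<le> \<eta>"
    and br: "\<And>x. x \<in> {lo..hi} \<Longrightarrow> \<exists>(L, H)\<in>\<B>. L \<subseteq> {z. z \<le> x} \<and> {z. z \<le> x} \<subseteq> H"
    unfolding brackets_on_def by auto
  define f where "f L p = indicator L (snd p) *\<^sub>R snd p" for L :: "(real^'d) set" and p :: "real \<times> (real^'d)"
  define h where "h B p = (indicator B (snd p) :: real)" for B :: "(real^'d) set" and p :: "real \<times> (real^'d)"
  have f: "f L \<in> borel_measurable borel" if "L \<in> sets borel" for L
    unfolding f_def[abs_def] by (intro borel_measurable_scaleR indicator_snd_measurable that measurable_snd_borel)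
  have h: "h B \<in> borel_measurable borel" if "B \<in> sets borel" for B
    unfolding h_def[abs_def] by (intro indicator_snd_measurable that)
  have fb: "norm (f L p) \<le> R" if "snd p \<in> {lo..hi}" for L p
    using R that by (auto simp: f_def indicator_def)
  have hb: "norm (h B p) \<le> 1" for B p
    by (auto simp: h_def indicator_def)
  have Eh: "(\<integral>\<omega>. h B (Z 1 2 \<omega>) \<partial>P) = measure \<nu> B" if "B \<in> sets borel" for B
  proof -
    have "(\<integral>\<omega>. h B (Z 1 2 \<omega>) \<partial>P) = (\<integral>z. indicator B z \<partial>\<nu>)"
      unfolding h_def \<nu>_def by (rule integral_distr[symmetric]) (use X12 that in auto)
    also have "\<dots> = measure \<nu> B" using that by (simp add: \<nu>_def)
    finally show ?thesis .
  qed
  have "with_prob_tending_to_1 P (\<lambda>n \<omega>. \<forall>q\<in>\<B>.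
      norm (emp_mean n (\<lambda>i j. Z i j \<omega>) (f (fst q)) - (\<integral>\<omega>. f (fst q) (Z 1 2 \<omega>) \<partial>P)) < e / 4 \<and>
      norm (emp_mean n (\<lambda>i j. Z i j \<omega>) (h (snd q - fst q)) - (\<integral>\<omega>. h (snd q - fst q) (Z 1 2 \<omega>) \<partial>P)) < \<eta>)"
  proof (intro with_prob_tending_to_1_ball_finite fin with_prob_tending_to_1_conj weak_law)
    fix q assume "q \<in> \<B>"
    then have q: "fst q \<in> sets borel" "snd q - fst q \<in> sets borel"
      using LH[of "fst q" "snd q"] by auto
    show "f (fst q) \<in> borel_measurable borel" "h (snd q - fst q) \<in> borel_measurable borel"
      using f h q by auto
    show "integrable P (\<lambda>\<omega>. (norm (f (fst q) (Z 1 2 \<omega>)))\<^sup>2)"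
      by (rule integrable_bounded_sq(2)[OF f[OF q(1)] fb])
    show "integrable P (\<lambda>\<omega>. (norm (h (snd q - fst q) (Z 1 2 \<omega>)))\<^sup>2)"
      by (rule integrable_bounded_sq(2)[OF h[OF q(2)] hb])
  qed (use e \<eta> in auto)
  then show ?thesis
  proof (rule with_prob_tending_to_1_mono, intro ballI)
    fix n \<omega> x
    let ?E = "emp_mean n (\<lambda>i j. Z i j \<omega>)"
    assume \<omega>: "\<omega> \<in> space P" and x: "x \<in> {lo..hi}"
      and law: "\<forall>q\<in>\<B>. norm (?E (f (fst q)) - (\<integral>\<omega>. f (fst q) (Z 1 2 \<omega>) \<partial>P)) < e / 4 \<and>
        norm (?E (h (snd q - fst q)) - (\<integral>\<omega>. h (snd q - fst q) (Z 1 2 \<omega>) \<partial>P)) < \<eta>"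
    obtain L H where q: "(L, H) \<in> \<B>" "L \<subseteq> {z. z \<le> x}" "{z. z \<le> x} \<subseteq> H" using br[OF x] by blast
    have meas: "L \<in> sets borel" "H - L \<in> sets borel" and small: "measure \<nu> (H - L) \<le> \<eta>" using LH[OF q(1)] by auto
    have lawL: "norm (?E (f L) - (\<integral>\<omega>. f L (Z 1 2 \<omega>) \<partial>P)) < e / 4"
      and lawH: "norm (?E (h (H - L)) - measure \<nu> (H - L)) < \<eta>"
      using law[rule_format, OF q(1)] Eh[OF meas(2)] by auto
    let ?m = "\<lambda>p :: real \<times> (real^'d). of_bool (snd p \<le> x) *\<^sub>R snd p"
    have empM: "emp_M n (\<lambda>i j. Z i j \<omega>) x = ?E ?m"
      unfolding emp_M_def by (simp add: case_prod_unfold)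
    have m: "?m \<in> borel_measurable borel"
    proof -
      have "?m = f {z. z \<le> x}" by (auto simp: f_def indicator_def)
      with f[OF orthant_set_measurable] show ?thesis by simp
    qed
    have mb: "norm (?m p) \<le> R" if "snd p \<in> {lo..hi}" for p using R that by auto
    have br_p: "norm (?m p - f L p) \<le> R * h (H - L) p" if "norm (snd p) \<le> R" for p
      unfolding f_def h_def by (rule indicator_X_bracket[OF q(2,3) that])
    have "norm (?E (\<lambda>p. ?m p - f L p)) \<le> ?E (\<lambda>p. R * h (H - L) p)"
      by (rule norm_emp_mean_le) (use br_p X_norm_dyads[OF _ \<omega>] in blast)
    also have "\<dots> = R * ?E (h (H - L))"
      by (rule emp_mean_linear) (auto intro: linearI simp: algebra_simps)
    also have "\<dots> \<le> R * (\<eta> + \<eta>)"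
      using lawH small R by (intro mult_left_mono) auto
    finally have 1: "norm (?E ?m - ?E (f L)) \<le> e / 2"
      unfolding emp_mean_diff using R by (simp add: \<eta>_def field_simps)
    note im = integrable_bounded_sq(1)[OF m mb] integrable_bounded_sq(1)[OF f[OF meas(1)] fb]
    have "pop_M P (Z 1 2) x - (\<integral>\<omega>. f L (Z 1 2 \<omega>) \<partial>P) = (\<integral>\<omega>. ?m (Z 1 2 \<omega>) - f L (Z 1 2 \<omega>) \<partial>P)"
      unfolding pop_M_def using im by simp
    also have "norm \<dots> \<le> (\<integral>\<omega>. norm (?m (Z 1 2 \<omega>) - f L (Z 1 2 \<omega>)) \<partial>P)"
      by (rule integral_norm_bound)
    also have "\<dots> \<le> (\<integral>\<omega>. R * h (H - L) (Z 1 2 \<omega>) \<partial>P)"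
    proof (rule integral_mono)
      show "integrable P (\<lambda>\<omega>. norm (?m (Z 1 2 \<omega>) - f L (Z 1 2 \<omega>)))"
        using im by (intro integrable_norm Bochner_Integration.integrable_diff)
      show "integrable P (\<lambda>\<omega>. R * h (H - L) (Z 1 2 \<omega>))"
        using integrable_bounded_sq(1)[OF h[OF meas(2)] hb] by simp
    qed (use br_p X_norm[of 1 2] in auto)
    also have "\<dots> = R * measure \<nu> (H - L)" using Eh[OF meas(2)] by simp
    also have "\<dots> \<le> R * \<eta>" using small R by (intro mult_left_mono) auto
    finally have 2: "norm (pop_M P (Z 1 2) x - (\<integral>\<omega>. f L (Z 1 2 \<omega>) \<partial>P)) \<le> e / 4"
      using R by (simp add: \<eta>_def)
    have eq: "emp_M n (\<lambda>i j. Z i j \<omega>) x - pop_M P (Z 1 2) x =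
      (?E ?m - ?E (f L)) + (?E (f L) - (\<integral>\<omega>. f L (Z 1 2 \<omega>) \<partial>P)) - (pop_M P (Z 1 2) x - (\<integral>\<omega>. f L (Z 1 2 \<omega>) \<partial>P))"
      unfolding empM by simp
    show "norm (emp_M n (\<lambda>i j. Z i j \<omega>) x - pop_M P (Z 1 2) x) \<le> e"
      unfolding eq using 1 2 lawL norm_triangle_ineq4[of "(?E ?m - ?E (f L)) + (?E (f L) - (\<integral>\<omega>. f L (Z 1 2 \<omega>) \<partial>P))"
          "pop_M P (Z 1 2) x - (\<integral>\<omega>. f L (Z 1 2 \<omega>) \<partial>P)"]
        norm_triangle_ineq[of "?E ?m - ?E (f L)" "?E (f L) - (\<integral>\<omega>. f L (Z 1 2 \<omega>) \<partial>P)"] by linarith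
  qed
qed

lemma XY_measurable: "(\<lambda>p :: real \<times> (real^'d). fst p *\<^sub>R snd p) \<in> borel_measurable borel"
  by (intro borel_measurable_continuous_onI continuous_intros)

lemma pop_M_norm: "norm (pop_M P (Z 1 2) x) \<le> R"
proof -
  have "norm (pop_M P (Z 1 2) x) \<le> (\<integral>\<omega>. norm (of_bool (snd (Z 1 2 \<omega>) \<le> x) *\<^sub>R snd (Z 1 2 \<omega>)) \<partial>P)"
    unfolding pop_M_def by (rule integral_norm_bound)
  also have "\<dots> \<le> (\<integral>\<omega>. R \<partial>P)"
    by (rule integral_mono') (use R X_norm[of 1 2] in auto)
  finally show ?thesis by (simp add: prob_space)
qed

text \<open>Dominated convergence with the constant \<open>R\<close>. This carries over to
  Q^{-1}M(x), as pointwise measurability requires.\<close>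

lemma pop_M_right_continuous:
  assumes "\<And>m. x \<le> xs m" "xs \<longlonglongrightarrow> x"
  shows "(\<lambda>m. pop_M P (Z 1 2) (xs m)) \<longlonglongrightarrow> pop_M P (Z 1 2) x"
  unfolding pop_M_def
proof (rule integral_dominated_convergence[where w = "\<lambda>_. R"])
  have 1: "(\<lambda>\<omega>. of_bool (snd (Z 1 2 \<omega>) \<le> y) *\<^sub>R snd (Z 1 2 \<omega>)) \<in> borel_measurable P" for y
  proof -
    have "(\<lambda>\<omega>. indicator {z. z \<le> y} (snd (Z 1 2 \<omega>)) *\<^sub>R snd (Z 1 2 \<omega>)) \<in> borel_measurable P"
      by (intro borel_measurable_scaleR X12 measurable_compose[OF X12 borel_measurable_indicator] orthant_set_measurable)
    then show ?thesis by (simp add: indicator_def)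
  qed
  show "(\<lambda>\<omega>. of_bool (snd (Z 1 2 \<omega>) \<le> x) *\<^sub>R snd (Z 1 2 \<omega>)) \<in> borel_measurable P" by (rule 1)
  show "(\<lambda>\<omega>. of_bool (snd (Z 1 2 \<omega>) \<le> xs m) *\<^sub>R snd (Z 1 2 \<omega>)) \<in> borel_measurable P" for m by (rule 1)
  show "AE \<omega> in P. (\<lambda>m. of_bool (snd (Z 1 2 \<omega>) \<le> xs m) *\<^sub>R snd (Z 1 2 \<omega>)) \<longlonglongrightarrow> of_bool (snd (Z 1 2 \<omega>) \<le> x) *\<^sub>R snd (Z 1 2 \<omega>)"
    by (intro AE_I2 tendsto_scaleR tendsto_of_bool_le_from_above tendsto_const assms)
  show "AE \<omega> in P. norm (of_bool (snd (Z 1 2 \<omega>) \<le> xs m) *\<^sub>R snd (Z 1 2 \<omega>)) \<le> R" for m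
    using R X_norm[of 1 2] by (auto intro!: AE_I2)
qed simp

lemma pop_Q_symmetric: "transpose (pop_Q P (Z 1 2)) = pop_Q P (Z 1 2)"
proof -
  have i: "integrable P (\<lambda>\<omega>. outer (snd (Z 1 2 \<omega>)))"
    by (rule integrable_bounded_sq(1)[OF outer_measurable outer_bound])
  have "bounded_linear (transpose :: real^'d^'d \<Rightarrow> real^'d^'d)"
    unfolding linear_conv_bounded_linear[symmetric] by (rule linear_transpose)
  from integral_bounded_linear[OF this i] show ?thesis
    unfolding pop_Q_def by (simp add: transpose_outer)
qed

lemma emp_Q_symmetric: "transpose (emp_Q n \<zeta>) = emp_Q n \<zeta>"
  using emp_mean_linear[OF linear_transpose, of n \<zeta> "\<lambda>p. outer (snd p)"]
  by (simp add: emp_Q_def case_prod_unfold transpose_outer)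

text \<open>Both estimators solve systems with the same matrix Q_n, with right-hand sides P_n(XY)
  and M_n(x). Uniformity in x comes from \<open>uniform_weak_law_M\<close> and the common bound R on
  M(x).\<close>

lemma estimators_consistent:
  assumes \<kappa>: "0 < \<kappa>" "\<And>v. \<kappa> * norm v \<le> norm (pop_Q P (Z 1 2) *v v)"
    and Y: "integrable P (\<lambda>\<omega>. (1 + \<bar>fst (Z 1 2 \<omega>)\<bar>) ^ 4)" and e: "0 < e"
  shows "with_prob_tending_to_1 P (\<lambda>n \<omega>. let \<zeta> = (\<lambda>i j. Z i j \<omega>) in
    invertible (emp_Q n \<zeta>) \<and>
    norm (matrix_inv (emp_Q n \<zeta>) *v emp_mean n \<zeta> (\<lambda>p. fst p *\<^sub>R snd p) - beta_star P (Z 1 2)) \<le> e \<and>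
    (\<forall>x\<in>{lo..hi}. norm (matrix_inv (emp_Q n \<zeta>) *v emp_M n \<zeta> x - matrix_inv (pop_Q P (Z 1 2)) *v pop_M P (Z 1 2) x) \<le> e))"
proof -
  let ?Q = "pop_Q P (Z 1 2)"
  define v where "v = (\<integral>\<omega>. fst (Z 1 2 \<omega>) *\<^sub>R snd (Z 1 2 \<omega>) \<partial>P)"
  \<comment> \<open>\<open>B\<close> bounds the population right-hand sides E[XY] and M(x).
    \<open>T\<close> is the factor by which \<open>perturbed_linear_system\<close> magnifies a
    common error e', and the other bound e' \<le> \<kappa>/2 is its smallness condition.\<close>
  define B where "B = max R (norm v)"
  define T where "T = 2 / \<kappa> * (1 + B / \<kappa>)"
  define e' where "e' = min (\<kappa> / 2) (e / T)"
  have B: "0 < B" "R \<le> B" "norm v \<le> B" using R by (auto simp: B_def)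
  have T: "0 < T" unfolding T_def using B(1) \<kappa>(1) by (intro mult_pos_pos add_pos_pos divide_pos_pos) simp_all
  have e': "0 < e'" "e' \<le> \<kappa> / 2" "T * e' \<le> e"
  proof -
    show "0 < e'" using \<kappa> e T by (simp add: e'_def)
    show "e' \<le> \<kappa> / 2" unfolding e'_def by (rule min.cobounded1)
    have "e' \<le> e / T" by (simp add: e'_def)
    then show "T * e' \<le> e" using T by (simp add: field_simps)
  qed
  have bound: "2 / \<kappa> * (s + t * u / \<kappa>) \<le> e" if "s \<le> e'" "0 \<le> t" "t \<le> e'" "0 \<le> u" "u \<le> B" for s t u
  proof -
    have "t * u \<le> e' * B" using that e' by (intro mult_mono) auto
    then have "2 / \<kappa> * (s + t * u / \<kappa>) \<le> 2 / \<kappa> * (e' + e' * B / \<kappa>)"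
      using \<kappa> that by (intro mult_left_mono add_mono divide_right_mono) auto
    also have "\<dots> = T * e'" by (simp add: T_def algebra_simps add_divide_distrib)
    finally show ?thesis using e' by simp
  qed
  have "with_prob_tending_to_1 P (\<lambda>n \<omega>.
      norm (emp_mean n (\<lambda>i j. Z i j \<omega>) (\<lambda>p. outer (snd p)) - (\<integral>\<omega>. outer (snd (Z 1 2 \<omega>)) \<partial>P)) < e' \<and>
      norm (emp_mean n (\<lambda>i j. Z i j \<omega>) (\<lambda>p. fst p *\<^sub>R snd p) - (\<integral>\<omega>. fst (Z 1 2 \<omega>) *\<^sub>R snd (Z 1 2 \<omega>) \<partial>P)) < e' \<and>
      (\<forall>x\<in>{lo..hi}. norm (emp_M n (\<lambda>i j. Z i j \<omega>) x - pop_M P (Z 1 2) x) \<le> e'))"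
  proof (intro with_prob_tending_to_1_conj weak_law uniform_weak_law_M e' outer_measurable XY_measurable)
    show "integrable P (\<lambda>\<omega>. (norm (outer (snd (Z 1 2 \<omega>))))\<^sup>2)"
      by (rule integrable_bounded_sq(2)[OF outer_measurable outer_bound])
    show "integrable P (\<lambda>\<omega>. (norm (fst (Z 1 2 \<omega>) *\<^sub>R snd (Z 1 2 \<omega>)))\<^sup>2)"
    proof (rule Bochner_Integration.integrable_bound)
      show "integrable P (\<lambda>\<omega>. R\<^sup>2 * (1 + \<bar>fst (Z 1 2 \<omega>)\<bar>) ^ 4)" using Y by simp
      have "(\<lambda>\<omega>. fst (Z 1 2 \<omega>) *\<^sub>R snd (Z 1 2 \<omega>)) \<in> borel_measurable P"
        by (rule measurable_compose[OF Z12 XY_measurable])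
      then show "(\<lambda>\<omega>. (norm (fst (Z 1 2 \<omega>) *\<^sub>R snd (Z 1 2 \<omega>)))\<^sup>2) \<in> borel_measurable P"
        by measurable
      show "AE \<omega> in P. norm ((norm (fst (Z 1 2 \<omega>) *\<^sub>R snd (Z 1 2 \<omega>)))\<^sup>2) \<le> norm (R\<^sup>2 * (1 + \<bar>fst (Z 1 2 \<omega>)\<bar>) ^ 4)"
      proof (rule AE_I2)
        fix \<omega> assume "\<omega> \<in> space P"
        then have x: "norm (snd (Z 1 2 \<omega>)) \<le> R" by (intro X_norm) auto
        let ?y = "\<bar>fst (Z 1 2 \<omega>)\<bar>"
        have "?y \<le> (1 + ?y) * 1" by simp
        also have "\<dots> \<le> (1 + ?y) * (1 + ?y)" by (intro mult_left_mono) auto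
        finally have "norm (fst (Z 1 2 \<omega>) *\<^sub>R snd (Z 1 2 \<omega>)) \<le> (1 + ?y)\<^sup>2 * R"
          unfolding norm_scaleR power2_eq_square using x by (intro mult_mono) auto
        then have "(norm (fst (Z 1 2 \<omega>) *\<^sub>R snd (Z 1 2 \<omega>)))\<^sup>2 \<le> ((1 + ?y)\<^sup>2 * R)\<^sup>2"
          by (intro power_mono) auto
        also have "\<dots> = R\<^sup>2 * (1 + ?y) ^ 4" by (simp add: power_mult_distrib)
        finally show "norm ((norm (fst (Z 1 2 \<omega>) *\<^sub>R snd (Z 1 2 \<omega>)))\<^sup>2) \<le> norm (R\<^sup>2 * (1 + ?y) ^ 4)" by simp
      qed
    qed
  qed
  then show ?thesis
  proof (rule with_prob_tending_to_1_mono)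
    fix n \<omega>
    let ?\<zeta> = "\<lambda>i j. Z i j \<omega>"
    assume "norm (emp_mean n ?\<zeta> (\<lambda>p. outer (snd p)) - (\<integral>\<omega>. outer (snd (Z 1 2 \<omega>)) \<partial>P)) < e' \<and>
      norm (emp_mean n ?\<zeta> (\<lambda>p. fst p *\<^sub>R snd p) - (\<integral>\<omega>. fst (Z 1 2 \<omega>) *\<^sub>R snd (Z 1 2 \<omega>) \<partial>P)) < e' \<and>
      (\<forall>x\<in>{lo..hi}. norm (emp_M n ?\<zeta> x - pop_M P (Z 1 2) x) \<le> e')"
    then have Qn: "norm (emp_Q n ?\<zeta> - ?Q) \<le> e'" and vn: "norm (emp_mean n ?\<zeta> (\<lambda>p. fst p *\<^sub>R snd p) - v) \<le> e'"
      and Mn: "\<And>x. x \<in> {lo..hi} \<Longrightarrow> norm (emp_M n ?\<zeta> x - pop_M P (Z 1 2) x) \<le> e'"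
      by (auto simp: emp_Q_def pop_Q_def case_prod_unfold v_def)
    have Qk: "norm (emp_Q n ?\<zeta> - ?Q) \<le> \<kappa> / 2" using Qn e' by simp
    note pert = perturbed_linear_system[OF \<kappa> Qk]
    have "norm (matrix_inv (emp_Q n ?\<zeta>) *v emp_mean n ?\<zeta> (\<lambda>p. fst p *\<^sub>R snd p) - beta_star P (Z 1 2)) \<le> e"
      unfolding beta_star_def v_def[symmetric]
      by (rule order_trans[OF pert(2) bound]) (use Qn vn B in auto)
    moreover have "norm (matrix_inv (emp_Q n ?\<zeta>) *v emp_M n ?\<zeta> x - matrix_inv ?Q *v pop_M P (Z 1 2) x) \<le> e"
      if "x \<in> {lo..hi}" for x
      by (rule order_trans[OF pert(2) bound]) (use Qn Mn[OF that] B pop_M_norm[of x] in auto)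
    ultimately show "let \<zeta> = ?\<zeta> in
      invertible (emp_Q n \<zeta>) \<and>
      norm (matrix_inv (emp_Q n \<zeta>) *v emp_mean n \<zeta> (\<lambda>p. fst p *\<^sub>R snd p) - beta_star P (Z 1 2)) \<le> e \<and>
      (\<forall>x\<in>{lo..hi}. norm (matrix_inv (emp_Q n \<zeta>) *v emp_M n \<zeta> x - matrix_inv ?Q *v pop_M P (Z 1 2) x) \<le> e)"
      using pert(1) by (simp add: Let_def)
  qed
qed

end

section \<open>The deviation class of the regression model, and the conclusion\<close>

lemma d_fun_eq_dev:
  assumes "invertible (pop_Q P W)" "transpose (pop_Q P W) = pop_Q P W"
  shows "d_fun P W x a b = dev (beta_star P W) x a (matrix_inv (pop_Q P W) *v pop_M P W x) b"
  unfolding d_fun_def h_fun_def r_fun_def dev_def fun_eq_iff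
  by (auto simp: inner_matrix_inv_symmetric[OF assms] inner_diff_right algebra_simps)

text \<open>The fourth power is the square of (1 + |Y|)^2, whose average obeys the weak law, and it
  also dominates the squared norm of XY. The estimate splits at |Y| = 1, with 16 = 2^4.\<close>

lemma (in finite_measure) integrable_one_plus_pow4:
  fixes Y :: "'a \<Rightarrow> real"
  assumes "Y \<in> borel_measurable M" "0 < \<delta>" "integrable M (\<lambda>\<omega>. \<bar>Y \<omega>\<bar> powr (4 + \<delta>))"
  shows "integrable M (\<lambda>\<omega>. (1 + \<bar>Y \<omega>\<bar>) ^ 4)"
proof (rule Bochner_Integration.integrable_bound)
  show "integrable M (\<lambda>\<omega>. 16 * (1 + \<bar>Y \<omega>\<bar> powr (4 + \<delta>)))" using assms by simp
  have "(1 + y) ^ 4 \<le> 16 * (1 + y powr (4 + \<delta>))" if "0 \<le> y" for y :: real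
  proof (cases "y \<le> 1")
    case True
    then have "(1 + y) ^ 4 \<le> 2 ^ 4" using that by (intro power_mono) auto
    also have "(2::real) ^ 4 \<le> 16 * (1 + y powr (4 + \<delta>))" by simp
    finally show ?thesis .
  next
    case False
    then have "(1 + y) ^ 4 \<le> (2 * y) ^ 4" by (intro power_mono) auto
    also have "\<dots> = 16 * y powr 4" using False by (simp add: power_mult_distrib powr_numeral)
    also have "\<dots> \<le> 16 * y powr (4 + \<delta>)" using False assms(2) by (intro mult_left_mono powr_mono) auto
    finally show ?thesis by simp
  qed
  then show "AE \<omega> in M. norm ((1 + \<bar>Y \<omega>\<bar>) ^ 4) \<le> norm (16 * (1 + \<bar>Y \<omega>\<bar> powr (4 + \<delta>)))"
    by (auto intro!: AE_I2)
qed (use assms in measurable)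

theorem lemma13:
  fixes P :: "'w measure" and NU :: "'u measure" and NV :: "'v measure"
    and U :: "nat \<Rightarrow> 'w \<Rightarrow> 'u" and V :: "nat \<Rightarrow> nat \<Rightarrow> 'w \<Rightarrow> 'v"
    and \<tau> :: "'u \<Rightarrow> 'u \<Rightarrow> 'v \<Rightarrow> real \<times> (real ^ 'd)"
    and Z :: "nat \<Rightarrow> nat \<Rightarrow> 'w \<Rightarrow> real \<times> (real ^ 'd)"
    and \<X> :: "(real ^ 'd) set" and S :: "(real \<times> (real ^ 'd)) set" and lo hi :: "real ^ 'd" and CX \<delta> :: real
    and \<beta>h :: "nat \<Rightarrow> 'w \<Rightarrow> real ^ 'd"
    and A :: "nat \<Rightarrow> 'w \<Rightarrow> real ^ 'd \<Rightarrow> real ^ 'd"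
    and rh :: "nat \<Rightarrow> 'w \<Rightarrow> nat \<Rightarrow> nat \<Rightarrow> real ^ 'd \<Rightarrow> real"
  assumes "prob_space P"
    and iid: "iid_nodes_dyads P NU NV U V"
    and tau_meas: "(\<lambda>(u, u', v). \<tau> u u' v) \<in> borel_measurable (NU \<Otimes>\<^sub>M NU \<Otimes>\<^sub>M NV)"
    and tau_sym: "\<And>u u' v. u \<in> space NU \<Longrightarrow> u' \<in> space NU \<Longrightarrow> v \<in> space NV \<Longrightarrow> \<tau> u u' v = \<tau> u' u v"
    and Z: "\<And>i j \<omega>. 1 \<le> i \<Longrightarrow> i < j \<Longrightarrow> \<omega> \<in> space P \<Longrightarrow> Z i j \<omega> = \<tau> (U i \<omega>) (U j \<omega>) (V i j \<omega>)"
    and rectangle: "\<X> = {lo..hi}"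
    and X_in: "\<And>i j \<omega>. 1 \<le> i \<Longrightarrow> i < j \<Longrightarrow> \<omega> \<in> space P \<Longrightarrow> snd (Z i j \<omega>) \<in> \<X>"
    and X_bounded: "AE \<omega> in P. norm (snd (Z 1 2 \<omega>)) \<le> CX"
    and Y_moment: "\<delta> > 0" "integrable P (\<lambda>\<omega>. \<bar>fst (Z 1 2 \<omega>)\<bar> powr (4 + \<delta>))"
    and Q_eigenvalues: "\<exists>c>0. \<forall>l. eigenvalue (pop_Q P (Z 1 2)) l \<longrightarrow> c \<le> l"
    and S: "S = UNIV \<times> (\<X> \<inter> {z. norm z \<le> CX})"
    and beta_hat: "\<And>n \<omega>. \<omega> \<in> space P \<Longrightarrow> is_beta_hat n (\<lambda>i j. Z i j \<omega>) (\<beta>h n \<omega>)"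
    and A_hat: "\<And>n \<omega>. \<omega> \<in> space P \<Longrightarrow> is_A_hat n (\<lambda>i j. Z i j \<omega>) (A n \<omega>)"
    and r_hat: "\<And>n \<omega>. \<omega> \<in> space P \<Longrightarrow> is_r_hat n (\<lambda>i j. Z i j \<omega>) (\<beta>h n \<omega>) (rh n \<omega>)"
  shows "\<exists>C C' A\<^sub>0 v\<^sub>0 :: real. 0 < A\<^sub>0 \<and> 0 < v\<^sub>0 \<and>
    (let D = (\<lambda>(y, z). C' * (1 + \<bar>y\<bar>)); \<D> = D_class P (Z 1 2) \<X> C in
      envelope_on S \<D> D \<and>
      (\<forall>\<epsilon>. 0 < \<epsilon> \<and> \<epsilon> \<le> 1 \<longrightarrow>
        (SUP L\<in>prob_measures_L2 S D. ereal_of_enat (covering_number (\<epsilon> * L2_norm L D) \<D> L))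
          \<le> ereal ((A\<^sub>0 / \<epsilon>) powr v\<^sub>0)) \<and>
      with_prob_tending_to_1 P (\<lambda>n \<omega>. \<forall>x\<in>\<X>.
        (\<forall>(i, j)\<in>dyads n. rh n \<omega> i j x - r_fun P (Z 1 2) x (Z i j \<omega>)
            = d_fun P (Z 1 2) x (A n \<omega> x) (\<beta>h n \<omega>) (Z i j \<omega>)) \<and>
        d_fun P (Z 1 2) x (A n \<omega> x) (\<beta>h n \<omega>) \<in> \<D>) \<and>
      op1 P (\<lambda>n \<omega>. emp_mean n (\<lambda>i j. Z i j \<omega>)
        (\<lambda>p. SUP x\<in>\<X>. \<bar>d_fun P (Z 1 2) x (A n \<omega> x) (\<beta>h n \<omega>) p\<bar>^2)) \<and>
      pointwise_measurable_on S \<D>)"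
proof -
  define W where "W = Z 1 2"
  define Q where "Q = pop_Q P W"
  define \<beta> where "\<beta> = beta_star P W"
  define g where "g x = matrix_inv Q *v pop_M P W x" for x
  obtain R0 where "\<And>z. z \<in> {lo..hi} \<Longrightarrow> norm z \<le> R0"
    using bounded_cbox[of lo hi] unfolding bounded_iff by (auto simp: interval_cbox)
  then obtain R where R: "1 \<le> R" "\<And>z. z \<in> {lo..hi} \<Longrightarrow> norm z \<le> R"
    by (metis max.cobounded1 max.coboundedI2 order_refl)
  interpret prob_space P by fact
  interpret dyadic_regression P NU NV U V \<tau> Z lo hi R
    by unfold_locales (use iid tau_meas Z X_in rectangle R in auto)
  obtain \<omega>0 where \<omega>0: "\<omega>0 \<in> space P" using not_empty by auto
  \<comment> \<open>A real supremum over the empty set is uninformative, so nonemptiness is needed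
    to bound the supremum over x. The rectangle contains the value of X_12 at any sample
    point.\<close>
  have X_ne: "{lo..hi} \<noteq> {}" using X_in[of 1 2 \<omega>0] \<omega>0 rectangle by auto

  have "linear ((*v) Q)" by simp
  moreover have "inj ((*v) Q)"
  proof -
    have "\<not> eigenvalue Q 0" using Q_eigenvalues unfolding Q_def W_def by fastforce
    then have "\<And>v. Q *v v = 0 \<Longrightarrow> v = 0" unfolding eigenvalue_def by auto
    then show ?thesis using linear_injective_0[OF \<open>linear ((*v) Q)\<close>] by auto
  qed
  \<comment> \<open>Zero is below every eigenvalue of Q, so Q is injective; an injective linear map
    in finite dimension is bounded below.\<close>
  ultimately obtain \<kappa> where \<kappa>: "0 < \<kappa>" "\<And>v. \<kappa> * norm v \<le> norm (Q *v v)"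
    using linear_inj_bounded_below_pos by metis
  note Q_inv = invertible_bounded_below[OF \<kappa>]
  have Q_sym: "transpose Q = Q" unfolding Q_def W_def by (rule pop_Q_symmetric)
  have d_fun: "d_fun P W x a b = dev \<beta> x a (g x) b" for x a b
    unfolding \<beta>_def g_def Q_def by (rule d_fun_eq_dev) (use Q_inv(1) Q_sym in \<open>auto simp: Q_def\<close>)
  have D_class: "D_class P W X C = dev_class \<beta> g X C" for X C
    unfolding D_class_def dev_class_def d_fun ..
  have g_norm: "norm (g x) \<le> R / \<kappa>" for x
    using Q_inv(2)[of "pop_M P W x"] divide_right_mono[OF pop_M_norm[of x], of \<kappa>] \<kappa>(1)
    unfolding g_def W_def by simp
  have g_cont: "(\<lambda>m. g (xs m)) \<longlonglongrightarrow> g x" if "\<And>m. x \<le> xs m" "xs \<longlonglongrightarrow> x" for x xs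
    unfolding g_def W_def
    by (intro bounded_linear.tendsto[OF matrix_vector_mul_bounded_linear] pop_M_right_continuous that)

  \<comment> \<open>Bounds \<beta> and every g(x) with a margin of 1, so that estimators within
    distance 1 of them still index members of the class.\<close>
  define C where "C = norm \<beta> + R / \<kappa> + 1"
  have C: "1 \<le> C" "norm \<beta> + 1 \<le> C" "R / \<kappa> + 1 \<le> C" using R \<kappa> by (auto simp: C_def)
  have gC: "norm (g x) \<le> C" for x using g_norm[of x] C by linarith
  define C' where "C' = 4 * R\<^sup>2 * C\<^sup>2"
  define A\<^sub>0 where "A\<^sub>0 = sqrt (20 * C * (real CARD('d))\<^sup>2 + 2)"
  define v\<^sub>0 where "v\<^sub>0 = 8 * real CARD('d)"
  define D where "D = (\<lambda>(y, z :: real^'d). C' * (1 + \<bar>y\<bar>))"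
  have S_norm: "norm (snd p) \<le> R" if "p \<in> S" for p
    using that R(2) unfolding S rectangle by auto

  have env: "envelope_on S (dev_class \<beta> g \<X> C) D"
    unfolding envelope_on_def dev_class_def D_def C'_def
    using dev_bound[OF R(1) S_norm C(1)] gC C by (fastforce simp: case_prod_unfold)
  have cov: "(SUP L\<in>prob_measures_L2 S D. ereal_of_enat (covering_number (\<epsilon> * L2_norm L D) (dev_class \<beta> g \<X> C) L))
      \<le> ereal ((A\<^sub>0 / \<epsilon>) powr v\<^sub>0)" if "0 < \<epsilon>" "\<epsilon> \<le> 1" for \<epsilon>
  proof (rule SUP_least)
    fix L assume "L \<in> prob_measures_L2 S D"
    then show "ereal_of_enat (covering_number (\<epsilon> * L2_norm L D) (dev_class \<beta> g \<X> C) L) \<le> ereal ((A\<^sub>0 / \<epsilon>) powr v\<^sub>0)"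
      unfolding D_def C'_def A\<^sub>0_def v\<^sub>0_def using that C gC
      by (intro covering_number_dev_class R S_norm) auto
  qed
  have pm: "pointwise_measurable_on S (dev_class \<beta> g \<X> C)"
    unfolding rectangle by (rule pointwise_measurable_dev_class) (rule g_cont)

  have Y: "integrable P (\<lambda>\<omega>. (1 + \<bar>fst (Z 1 2 \<omega>)\<bar>) ^ 4)"
    by (rule integrable_one_plus_pow4[OF measurable_compose[OF Z12 measurable_fst_borel] Y_moment])
  \<comment> \<open>Where Q_n is invertible the candidates \<open>\<beta>h\<close> and
    \<open>A\<close> are forced to equal the formulas for which consistency is known.\<close>
  have cons: "with_prob_tending_to_1 P (\<lambda>n \<omega>. invertible (emp_Q n (\<lambda>i j. Z i j \<omega>)) \<and>
      norm (\<beta>h n \<omega> - \<beta>) \<le> e \<and> (\<forall>x\<in>\<X>. norm (A n \<omega> x - g x) \<le> e))" if "0 < e" for e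
  proof (rule with_prob_tending_to_1_mono[OF estimators_consistent[OF \<kappa>[unfolded Q_def W_def] Y that]])
    fix n \<omega> assume \<omega>: "\<omega> \<in> space P"
    assume "let \<zeta> = \<lambda>i j. Z i j \<omega> in
      invertible (emp_Q n \<zeta>) \<and>
      norm (matrix_inv (emp_Q n \<zeta>) *v emp_mean n \<zeta> (\<lambda>p. fst p *\<^sub>R snd p) - beta_star P (Z 1 2)) \<le> e \<and>
      (\<forall>x\<in>{lo..hi}. norm (matrix_inv (emp_Q n \<zeta>) *v emp_M n \<zeta> x - matrix_inv (pop_Q P (Z 1 2)) *v pop_M P (Z 1 2) x) \<le> e)"
    then show "invertible (emp_Q n (\<lambda>i j. Z i j \<omega>)) \<and>
      norm (\<beta>h n \<omega> - \<beta>) \<le> e \<and> (\<forall>x\<in>\<X>. norm (A n \<omega> x - g x) \<le> e)"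
      using beta_hat[OF \<omega>, of n] A_hat[OF \<omega>, of n]
      by (simp add: Let_def is_beta_hat_def is_A_hat_def rectangle \<beta>_def g_def Q_def W_def case_prod_unfold)
  qed
  have emb: "with_prob_tending_to_1 P (\<lambda>n \<omega>. \<forall>x\<in>\<X>.
        (\<forall>(i, j)\<in>dyads n. rh n \<omega> i j x - r_fun P W x (Z i j \<omega>) = d_fun P W x (A n \<omega> x) (\<beta>h n \<omega>) (Z i j \<omega>)) \<and>
        d_fun P W x (A n \<omega> x) (\<beta>h n \<omega>) \<in> dev_class \<beta> g \<X> C)"
  proof (rule with_prob_tending_to_1_mono[OF cons[OF zero_less_one]], intro ballI conjI)
    fix n \<omega> x
    assume \<omega>: "\<omega> \<in> space P" and x: "x \<in> \<X>" and H: "invertible (emp_Q n (\<lambda>i j. Z i j \<omega>)) \<and>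
      norm (\<beta>h n \<omega> - \<beta>) \<le> 1 \<and> (\<forall>x\<in>\<X>. norm (A n \<omega> x - g x) \<le> 1)"
    have "norm (\<beta>h n \<omega>) \<le> C" "norm (A n \<omega> x) \<le> C"
      using H x norm_triangle_sub[of "\<beta>h n \<omega>" \<beta>] norm_triangle_sub[of "A n \<omega> x" "g x"] g_norm[of x] C by force+
    then show "d_fun P W x (A n \<omega> x) (\<beta>h n \<omega>) \<in> dev_class \<beta> g \<X> C"
      unfolding d_fun dev_class_def using x by blast
    fix p assume p: "p \<in> dyads n"
    have An: "A n \<omega> x = matrix_inv (emp_Q n (\<lambda>i j. Z i j \<omega>)) *v emp_M n (\<lambda>i j. Z i j \<omega>) x"
      using A_hat[OF \<omega>, of n] H by (simp add: is_A_hat_def)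
    obtain i j where ij: "p = (i, j)" by (cases p)
    \<comment> \<open>Symmetry of Q_n moves the inverse from the regressor to M_n(x), which produces
      A_n(x)'z.\<close>
    have "rh n \<omega> i j x = (fst (Z i j \<omega>) - snd (Z i j \<omega>) \<bullet> \<beta>h n \<omega>) *
        (of_bool (snd (Z i j \<omega>) \<le> x) - A n \<omega> x \<bullet> snd (Z i j \<omega>))"
      using r_hat[OF \<omega>, of n] H p inner_matrix_inv_symmetric[OF _ emp_Q_symmetric, of n "\<lambda>i j. Z i j \<omega>"]
      unfolding is_r_hat_def An ij by fastforce
    then show "case p of (i, j) \<Rightarrow> rh n \<omega> i j x - r_fun P W x (Z i j \<omega>) = d_fun P W x (A n \<omega> x) (\<beta>h n \<omega>) (Z i j \<omega>)"
      unfolding ij by (simp add: d_fun_def h_fun_def case_prod_unfold)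
  qed

  define m2 where "m2 = (\<integral>\<omega>. (1 + \<bar>fst (Z 1 2 \<omega>)\<bar>)\<^sup>2 \<partial>P)"
  have m2: "0 \<le> m2" unfolding m2_def by simp
  \<comment> \<open>Tolerance 1 is enough: the empirical second moment just has to stay bounded,
    since it is multiplied by a factor of order e^2.\<close>
  have Y2: "with_prob_tending_to_1 P (\<lambda>n \<omega>. norm (emp_mean n (\<lambda>i j. Z i j \<omega>) (\<lambda>p. (1 + \<bar>fst p\<bar>)\<^sup>2) - m2) < 1)"
    unfolding m2_def
  proof (rule weak_law)
    show "(\<lambda>p :: real \<times> (real^'d). (1 + \<bar>fst p\<bar>)\<^sup>2) \<in> borel_measurable borel"
      by (intro borel_measurable_continuous_onI continuous_intros)
    show "integrable P (\<lambda>\<omega>. (norm ((1 + \<bar>fst (Z 1 2 \<omega>)\<bar>)\<^sup>2))\<^sup>2)" using Y by simp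
  qed simp
  have op: "op1 P (\<lambda>n \<omega>. emp_mean n (\<lambda>i j. Z i j \<omega>) (\<lambda>p. SUP x\<in>\<X>. \<bar>d_fun P W x (A n \<omega> x) (\<beta>h n \<omega>) p\<bar>^2))"
    unfolding op1_def
  proof (intro allI impI)
    fix \<epsilon> :: real assume \<epsilon>: "0 < \<epsilon>"
    \<comment> \<open>The final bound is K e^2, with (C')^2 from the Lipschitz estimate and m2 + 1
      from the empirical second moment. As e \<le> 1, it is enough that K e \<le>
      \<epsilon>.\<close>
    define K where "K = (4 * R\<^sup>2 * C\<^sup>2)\<^sup>2 * (m2 + 1)"
    have K: "0 < K" unfolding K_def using R C m2 by (intro mult_pos_pos zero_less_power) auto
    define e where "e = min 1 (\<epsilon> / K)"
    have e: "0 < e" "e \<le> 1" "K * e \<le> \<epsilon>"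
    proof -
      show "0 < e" "e \<le> 1" using \<epsilon> K by (auto simp: e_def)
      have "e \<le> \<epsilon> / K" by (simp add: e_def)
      then show "K * e \<le> \<epsilon>" using K by (simp add: field_simps)
    qed
    show "with_prob_tending_to_1 P (\<lambda>n \<omega>. \<bar>emp_mean n (\<lambda>i j. Z i j \<omega>)
        (\<lambda>p. SUP x\<in>\<X>. \<bar>d_fun P W x (A n \<omega> x) (\<beta>h n \<omega>) p\<bar>\<^sup>2)\<bar> \<le> \<epsilon>)"
    proof (rule with_prob_tending_to_1_mono[OF with_prob_tending_to_1_conj[OF cons[OF e(1)] Y2]])
      fix n \<omega> assume \<omega>: "\<omega> \<in> space P"
      let ?E = "emp_mean n (\<lambda>i j. Z i j \<omega>)"
      assume H: "(invertible (emp_Q n (\<lambda>i j. Z i j \<omega>)) \<and> norm (\<beta>h n \<omega> - \<beta>) \<le> e \<and> (\<forall>x\<in>\<X>. norm (A n \<omega> x - g x) \<le> e)) \<and>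
        norm (?E (\<lambda>p. (1 + \<bar>fst p\<bar>)\<^sup>2) - m2) < 1"
      let ?c = "4 * R\<^sup>2 * C\<^sup>2 * e"
      have d: "\<bar>d_fun P W x (A n \<omega> x) (\<beta>h n \<omega>) p\<bar>\<^sup>2 \<le> ?c\<^sup>2 * (1 + \<bar>fst p\<bar>)\<^sup>2"
        if x: "x \<in> \<X>" and p: "norm (snd p) \<le> R" for x p
      proof -
        have b: "norm (\<beta>h n \<omega>) \<le> C"
          using H e norm_triangle_sub[of "\<beta>h n \<omega>" \<beta>] C by force
        \<comment> \<open>A zero is subtracted, namely \<open>dev\<close> at a = c = g(x) and b =
          \<beta>. Both terms have the same x, so the indicator part of \<open>dev_diff\<close>
          drops out.\<close>
        have "\<bar>d_fun P W x (A n \<omega> x) (\<beta>h n \<omega>) p\<bar> = \<bar>dev \<beta> x (A n \<omega> x) (g x) (\<beta>h n \<omega>) p - dev \<beta> x (g x) (g x) \<beta> p\<bar>"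
          by (simp add: d_fun dev_self)
        also have "\<dots> \<le> 2 * R\<^sup>2 * C\<^sup>2 * (\<bar>of_bool (snd p \<le> x) - of_bool (snd p \<le> x)\<bar> + (1 + \<bar>fst p\<bar>) *
            (norm (A n \<omega> x - g x) + norm (\<beta>h n \<omega> - \<beta>) + norm (g x - g x)))"
          by (rule dev_diff[OF R(1) p C(1)]) (use C gC b in auto)
        also have "\<dots> \<le> 2 * R\<^sup>2 * C\<^sup>2 * (0 + (1 + \<bar>fst p\<bar>) * (e + e + 0))"
          using H x by (intro mult_left_mono add_mono) auto
        also have "\<dots> = ?c * (1 + \<bar>fst p\<bar>)" by (simp add: algebra_simps)
        finally have "\<bar>d_fun P W x (A n \<omega> x) (\<beta>h n \<omega>) p\<bar>\<^sup>2 \<le> (?c * (1 + \<bar>fst p\<bar>))\<^sup>2"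
          by (intro power_mono) auto
        then show ?thesis by (simp add: power_mult_distrib)
      qed
      \<comment> \<open>The bound \<open>d\<close> does not depend on x, so it passes to the
        supremum at each observation.\<close>
      have "\<bar>?E (\<lambda>p. SUP x\<in>\<X>. \<bar>d_fun P W x (A n \<omega> x) (\<beta>h n \<omega>) p\<bar>\<^sup>2)\<bar> \<le> ?E (\<lambda>p. ?c\<^sup>2 * (1 + \<bar>fst p\<bar>)\<^sup>2)"
        unfolding real_norm_def[symmetric]
      proof (rule norm_emp_mean_le, unfold real_norm_def)
        fix i j assume "(i, j) \<in> dyads n"
        then have "norm (snd (Z i j \<omega>)) \<le> R" using X_norm_dyads \<omega> by blast
        then show "\<bar>SUP x\<in>\<X>. \<bar>d_fun P W x (A n \<omega> x) (\<beta>h n \<omega>) (Z i j \<omega>)\<bar>\<^sup>2\<bar> \<le> ?c\<^sup>2 * (1 + \<bar>fst (Z i j \<omega>)\<bar>)\<^sup>2"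
          using X_ne rectangle d[of _ "Z i j \<omega>"] by (intro cSup_abs_le) auto
      qed
      also have "\<dots> = ?c\<^sup>2 * ?E (\<lambda>p. (1 + \<bar>fst p\<bar>)\<^sup>2)"
        by (rule emp_mean_linear) (auto intro: linearI simp: algebra_simps)
      also have "\<dots> \<le> ?c\<^sup>2 * (m2 + 1)" using H by (intro mult_left_mono) auto
      also have "\<dots> = K * (e * e)" by (simp add: K_def power_mult_distrib power2_eq_square)
      also have "\<dots> \<le> K * (e * 1)" using e K by (intro mult_left_mono) auto
      finally show "\<bar>?E (\<lambda>p. SUP x\<in>\<X>. \<bar>d_fun P W x (A n \<omega> x) (\<beta>h n \<omega>) p\<bar>\<^sup>2)\<bar> \<le> \<epsilon>" using e by simp
    qed
  qed
  have pos: "0 < A\<^sub>0" "0 < v\<^sub>0" using C by (auto simp: A\<^sub>0_def v\<^sub>0_def intro!: add_nonneg_pos)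
  show ?thesis
    unfolding Let_def W_def[symmetric] D_class
    by (rule exI[of _ C], rule exI[of _ C'], rule exI[of _ A\<^sub>0], rule exI[of _ v\<^sub>0])
      (use env[unfolded D_def] cov[unfolded D_def] emb op pm pos in blast)
qed

end
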